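(* Let $\nu\in\{3,4,5\}$ and consider the Adams--Moulton method AM$\nu$. Assume the inverse inequality $$\|GV_h\|_\Omega\le C_Gh^{-1}\|V_h\|_\Omega\qquad\forall V_h\in\mathcal V_h$$ and the conditions $$0<\delta\le C_\delta h,\qquad \tau\le c_0C_G^{-1}h,$$ with $c_0>0$ sufficiently small. For AM3 also assume $\tau\le C_{4/3}h^{4/3}$, and for AM4 assume $\tau\le C_{6/5}h^{6/5}$ (no smallness of $C_{4/3}$, $C_{6/5}$ is required). If $V_h^n\in\mathcal V_h$, $0\le n\le N$, solves $$(A_\tau V_h^n,T_\delta W)_\Omega=(R^n,T_\delta W)_\Omega\qquad\forall W\in\mathcal V_h,\ n_0(\nu)\le n\le N,$$ with $R^n\in\mathcal H$, then $$\|V_h\|_{\mathcal E_\nu,N}^2\lesssim\mathcal I_\tau(V_h)+\|R\|_{\mathcal E_\nu^*,N}^2+\tau\|R\|_{\ell_\tau^2(n_0(\nu),N;\mathcal H)}^2 .$$ For AM3 and AM4 the hidden constant depends exponentially on $T\,C_{4/3}^{3}$ and $T\,C_{6/5}^{5}$, respectively; for AM5 it is independent of any strengthened CFL constant. Only the upper bound $0<\delta\le C_\delta h$ is required of $\delta$, so that all three conclusions include the symmetric positive definite normal-equation choice $\delta=b_0\tau$ under the stated CFL conditions.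
   Context: Setting. $\mathcal H$ is a real Hilbert space (in the application $[L^2(\Omega)]^{n_{\rm sys}}$) with inner product $(\cdot,\cdot)_\Omega$ and norm $\|\cdot\|_\Omega$; $\mathcal V\subset\mathcal H$ is dense; $G:\mathcal V\to\mathcal H$ is linear, time independent, with $(GU,V)_\Omega=-(U,GV)_\Omega$ for all $U,V\in\mathcal V$; $\mathcal V_h\subset\mathcal V$ is a finite-dimensional (conforming finite element) subspace with mesh size $h$. $\tau>0$, $t^n=n\tau$ ($0\le n\le N$), $t^N\le T$, $\delta>0$. AM$\nu$: $D_\tau^-V^n=\tau^{-1}(V^n-V^{n-1})$ and $\mathcal M_\tau V^n=\mathcal M_{\mathrm{AM}\nu}V^n=\sum_{j=0}^{\nu-1}b_jV^{n-j}$ with AM3: $(b_0,b_1,b_2)=(\frac5{12},\frac23,-\frac1{12})$; AM4: $(b_0,\dots,b_3)=(\frac38,\frac{19}{24},-\frac5{24},\frac1{24})$; AM5: $(b_0,\dots,b_4)=(\frac{251}{720},\frac{646}{720},-\frac{264}{720},\frac{106}{720},-\frac{19}{720})$. First computed indices: $n_0(3)=2$, $n_0(4)=3$, $n_0(5)=4$; $N\ge n_0(\nu)$. Increments: $d^1V^n=V^n-V^{n-1}$, $d^jV^n=d^{j-1}V^n-d^{j-1}V^{n-1}$. Operators: $T_\delta=\mathrm{Id}+\delta G$, $S_\delta=\mathcal M_\tau+\delta D_\tau^-$, $A_\tau=D_\tau^-+G\mathcal M_\tau$, $P_\delta=T_\delta S_\delta$. Graph norm: $\|V\|_\delta^2=\|V\|_\Omega^2+\delta^2\|GV\|_\Omega^2=\|T_\delta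 V\|_\Omega^2$. Norms. $\mathcal I_\tau(V)=\sum_{j=0}^{n_0(\nu)-1}\|T_\delta V^j\|_\Omega^2$; $\|R\|_{\ell_\tau^2(a,b;\mathcal H)}^2=\tau\sum_{n=a}^b\|R^n\|_\Omega^2$. For $n_0(\nu)\le m\le N$, $$\|V\|_{\mathcal E_\nu,m}^2=\max_{n_0(\nu)\le n\le m}\|T_\delta V^n\|_\Omega^2+\tau\delta\sum_{n=n_0(\nu)}^m\|A_\tau V^n\|_\Omega^2\quad(\nu=3,4),$$ $$\|V\|_{\mathcal E_5,m}^2=\max_{4\le n\le m}\|T_\delta V^n\|_\Omega^2+\tau\delta\sum_{n=4}^m\|A_\tau V^n\|_\Omega^2+\sum_{n=4}^{m-1}\|d^3V^n\|_\delta^2,$$ $$\|R\|_{\mathcal E_\nu^*,N}=\max_{n_0(\nu)\le m\le N}\ \sup_V\ \frac{\tau\sum_{n=n_0(\nu)}^m(R^n,P_\delta V^n)_\Omega}{\bigl(\mathcal I_\tau(V)+\|V\|_{\mathcal E_\nu,m}^2\bigr)^{1/2}},$$ the supremum being over $\mathcal V_h$-valued sequences with $V^n=0$ for $n\notin\{0,\dots,m\}$ and positive denominator. Conventions: $a\lesssim b$ means $a\le Cb$ with $C>0$ independent of $h$, $\tau$, $N$ and of the sequences; "$c_0$ sufficiently small" means $c_0\le c_*$ for a threshold $c_*>0$ independent of $h$, $\tau$, $N$. The choice $\delta=b_0\tau$ is called the normal-equation choice because the scheme is then the Euler--Lagrange equation of minimising $\|D_\tau^-V^n+G\mathcal M_\tau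 V^n-\mathcal M_\tau F^n\|_\Omega^2$ over $V^n\in\mathcal V_h$. *)

theory Defs
  imports "HOL-Analysis.Analysis"
begin

text \<open>
  Sequences \<open>V\<^sup>0, V\<^sup>1, \<dots>\<close> are functions on \<^typ>\<open>nat\<close>. Backward differences and
  multistep averages at index \<open>n\<close> are only ever evaluated where all the indices \<open>n - j\<close>
  involved are genuine, so truncated subtraction never takes effect.
\<close>

text \<open>The operator is a total function; only its values on \<open>\<V>\<close> are constrained or used.\<close>

definition skew_operator :: "'a::{real_inner,complete_space} set \<Rightarrow> ('a \<Rightarrow> 'a) \<Rightarrow> bool" where
  "skew_operator \<V> G \<longleftrightarrow>
     subspace \<V> \<and> closure \<V> = UNIV \<and>
     (\<forall>U\<in>\<V>. \<forall>W\<in>\<V>. G (U + W) = G U + G W) \<and>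
     (\<forall>c. \<forall>U\<in>\<V>. G (c *\<^sub>R U) = c *\<^sub>R G U) \<and>
     (\<forall>U\<in>\<V>. \<forall>W\<in>\<V>. inner (G U) W = - inner U (G W))"

definition finite_dim_subspace :: "'a::real_vector set \<Rightarrow> bool" where
  "finite_dim_subspace W \<longleftrightarrow> (\<exists>B. finite B \<and> W = span B)"

definition inverse_inequality :: "('a::real_normed_vector \<Rightarrow> 'a) \<Rightarrow> 'a set \<Rightarrow> real \<Rightarrow> real \<Rightarrow> bool" where
  "inverse_inequality G Vh C_G h \<longleftrightarrow> (\<forall>W\<in>Vh. norm (G W) \<le> C_G / h * norm W)"

definition am_coeff :: "nat \<Rightarrow> nat \<Rightarrow> real" where
  "am_coeff \<nu> j =
     (if \<nu> = 3 then [5/12, 2/3, -1/12] ! j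
      else if \<nu> = 4 then [3/8, 19/24, -5/24, 1/24] ! j
      else if \<nu> = 5 then [251/720, 646/720, -264/720, 106/720, -19/720] ! j
      else 0)"

text \<open>First computed index.\<close>

definition n0 :: "nat \<Rightarrow> nat" where
  "n0 \<nu> = \<nu> - 1"

definition D_op :: "real \<Rightarrow> (nat \<Rightarrow> 'a::real_vector) \<Rightarrow> nat \<Rightarrow> 'a" where
  "D_op \<tau> V n = (1 / \<tau>) *\<^sub>R (V n - V (n - 1))"

definition M_op :: "nat \<Rightarrow> (nat \<Rightarrow> 'a::real_vector) \<Rightarrow> nat \<Rightarrow> 'a" where
  "M_op \<nu> V n = (\<Sum>j<\<nu>. am_coeff \<nu> j *\<^sub>R V (n - j))"

primrec incr :: "nat \<Rightarrow> (nat \<Rightarrow> 'a::real_vector) \<Rightarrow> nat \<Rightarrow> 'a" where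
  "incr 0 V n = V n"
| "incr (Suc j) V n = incr j V n - incr j V (n - 1)"

definition T_op :: "('a \<Rightarrow> 'a::real_vector) \<Rightarrow> real \<Rightarrow> 'a \<Rightarrow> 'a" where
  "T_op G \<delta> U = U + \<delta> *\<^sub>R G U"

definition S_op :: "nat \<Rightarrow> real \<Rightarrow> real \<Rightarrow> (nat \<Rightarrow> 'a::real_vector) \<Rightarrow> nat \<Rightarrow> 'a" where
  "S_op \<nu> \<tau> \<delta> V n = M_op \<nu> V n + \<delta> *\<^sub>R D_op \<tau> V n"

definition A_op :: "nat \<Rightarrow> ('a \<Rightarrow> 'a::real_vector) \<Rightarrow> real \<Rightarrow> (nat \<Rightarrow> 'a) \<Rightarrow> nat \<Rightarrow> 'a" where
  "A_op \<nu> G \<tau> V n = D_op \<tau> V n + G (M_op \<nu> V n)"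

definition P_op :: "nat \<Rightarrow> ('a \<Rightarrow> 'a::real_vector) \<Rightarrow> real \<Rightarrow> real \<Rightarrow> (nat \<Rightarrow> 'a) \<Rightarrow> nat \<Rightarrow> 'a" where
  "P_op \<nu> G \<tau> \<delta> V n = T_op G \<delta> (S_op \<nu> \<tau> \<delta> V n)"

definition graph_norm_sq :: "('a \<Rightarrow> 'a::real_normed_vector) \<Rightarrow> real \<Rightarrow> 'a \<Rightarrow> real" where
  "graph_norm_sq G \<delta> U = (norm U)\<^sup>2 + \<delta>\<^sup>2 * (norm (G U))\<^sup>2"

definition initial_sq :: "nat \<Rightarrow> ('a \<Rightarrow> 'a::real_normed_vector) \<Rightarrow> real \<Rightarrow> (nat \<Rightarrow> 'a) \<Rightarrow> real" where
  "initial_sq \<nu> G \<delta> V = (\<Sum>j<n0 \<nu>. (norm (T_op G \<delta> (V j)))\<^sup>2)"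

definition l2_norm_sq :: "real \<Rightarrow> nat \<Rightarrow> nat \<Rightarrow> (nat \<Rightarrow> 'a::real_normed_vector) \<Rightarrow> real" where
  "l2_norm_sq \<tau> a b R = \<tau> * (\<Sum>n=a..b. (norm (R n))\<^sup>2)"

definition energy_norm_sq ::
    "nat \<Rightarrow> ('a \<Rightarrow> 'a::real_normed_vector) \<Rightarrow> real \<Rightarrow> real \<Rightarrow> nat \<Rightarrow> (nat \<Rightarrow> 'a) \<Rightarrow> real" where
  "energy_norm_sq \<nu> G \<tau> \<delta> m V =
     Max ((\<lambda>n. (norm (T_op G \<delta> (V n)))\<^sup>2) ` {n0 \<nu>..m})
     + \<tau> * \<delta> * (\<Sum>n=n0 \<nu>..m. (norm (A_op \<nu> G \<tau> V n))\<^sup>2)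
     + (if \<nu> = 5 then (\<Sum>n=4..<m. graph_norm_sq G \<delta> (incr 3 V n)) else 0)"

text \<open>
  The set of quotients is bounded above and symmetric under \<open>V \<mapsto> - V\<close>. The inserted 0
  therefore only matters for the trivial space \<open>Vh = {0}\<close>, where there is no \<open>V\<close> with a
  positive denominator; the supremum is then 0.
\<close>

definition dual_norm ::
    "nat \<Rightarrow> ('a \<Rightarrow> 'a::real_inner) \<Rightarrow> 'a set \<Rightarrow> real \<Rightarrow> real \<Rightarrow> nat \<Rightarrow> (nat \<Rightarrow> 'a) \<Rightarrow> real" where
  "dual_norm \<nu> G Vh \<tau> \<delta> N R =
     Max ((\<lambda>m. Sup (insert 0
       {\<tau> * (\<Sum>n=n0 \<nu>..m. inner (R n) (P_op \<nu> G \<tau> \<delta> V n))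
          / sqrt (initial_sq \<nu> G \<delta> V + energy_norm_sq \<nu> G \<tau> \<delta> m V) | V.
        (\<forall>n. V n \<in> Vh) \<and> (\<forall>n>m. V n = 0) \<and>
        initial_sq \<nu> G \<delta> V + energy_norm_sq \<nu> G \<tau> \<delta> m V > 0})) ` {n0 \<nu>..N})"

definition solves_scheme ::
    "nat \<Rightarrow> ('a \<Rightarrow> 'a::real_inner) \<Rightarrow> 'a set \<Rightarrow> real \<Rightarrow> real \<Rightarrow> nat \<Rightarrow> (nat \<Rightarrow> 'a) \<Rightarrow> (nat \<Rightarrow> 'a) \<Rightarrow> bool" where
  "solves_scheme \<nu> G Vh \<tau> \<delta> N V R \<longleftrightarrow>
     (\<forall>n\<le>N. V n \<in> Vh) \<and>
     (\<forall>n\<in>{n0 \<nu>..N}. \<forall>W\<in>Vh.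
        inner (A_op \<nu> G \<tau> V n) (T_op G \<delta> W) = inner (R n) (T_op G \<delta> W))"

definition stability_estimate ::
    "nat \<Rightarrow> 'a::real_inner set \<Rightarrow> ('a \<Rightarrow> 'a) \<Rightarrow> real \<Rightarrow> real \<Rightarrow> real \<Rightarrow> real \<Rightarrow> real \<Rightarrow> real \<Rightarrow> bool" where
  "stability_estimate \<nu> \<V> G C_G h \<tau> \<delta> T C \<longleftrightarrow>
     (\<forall>Vh N V R.
        finite_dim_subspace Vh \<and> Vh \<subseteq> \<V> \<and> inverse_inequality G Vh C_G h \<and>
        n0 \<nu> \<le> N \<and> real N * \<tau> \<le> T \<and> solves_scheme \<nu> G Vh \<tau> \<delta> N V R \<longrightarrow>
        energy_norm_sq \<nu> G \<tau> \<delta> N V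
          \<le> C * (initial_sq \<nu> G \<delta> V + (dual_norm \<nu> G Vh \<tau> \<delta> N R)\<^sup>2
                 + \<tau> * l2_norm_sq \<tau> (n0 \<nu>) N R))"

text \<open>The CFL conditions; the strengthened ones concern only \<open>\<nu> = 3\<close> and \<open>\<nu> = 4\<close>.\<close>

definition cfl :: "nat \<Rightarrow> real \<Rightarrow> real \<Rightarrow> real \<Rightarrow> real \<Rightarrow> real \<Rightarrow> real \<Rightarrow> bool" where
  "cfl \<nu> C_G c0 C43 C65 h \<tau> \<longleftrightarrow>
     \<tau> \<le> c0 / C_G * h \<and>
     (\<nu> = 3 \<longrightarrow> \<tau> \<le> C43 * h powr (4/3)) \<and>
     (\<nu> = 4 \<longrightarrow> \<tau> \<le> C65 * h powr (6/5))"

definition growth_exponent :: "nat \<Rightarrow> real \<Rightarrow> real \<Rightarrow> real \<Rightarrow> real" where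
  "growth_exponent \<nu> T C43 C65 =
     (if \<nu> = 3 then T * C43 ^ 3 else if \<nu> = 4 then T * C65 ^ 5 else 0)"

text \<open>
  The bilinear form of the linear system solved for the unknown \<open>V\<^sup>n\<close>: by linearity, the part
  of \<open>(A\<^sub>\<tau> V\<^sup>n, T\<^sub>\<delta> W)\<close> that depends on \<open>V\<^sup>n\<close> comes from the sequence that vanishes except at \<open>n\<close>.
\<close>

definition step_form ::
    "nat \<Rightarrow> ('a \<Rightarrow> 'a::real_inner) \<Rightarrow> real \<Rightarrow> real \<Rightarrow> nat \<Rightarrow> 'a \<Rightarrow> 'a \<Rightarrow> real" where
  "step_form \<nu> G \<tau> \<delta> n U W =
     inner (A_op \<nu> G \<tau> ((\<lambda>_. 0)(n := U)) n) (T_op G \<delta> W)"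

end

theory Submission
  imports Defs
begin

text \<open>
  Put \<open>X = T\<^sub>\<delta> V\<close>. Because \<open>G\<close> is skew, \<open>T\<^sub>\<delta>\<close> is an isometry from the graph norm to the norm of the Hilbert
  space, so everything can be said about the sequence \<open>X\<close>. Testing the scheme with \<open>W = S\<^sub>\<delta> V\<^sup>n\<close>, all
  terms without a sign cancel by skewness and there remains the energy identity
  \<open>(R\<^sup>n, P\<^sub>\<delta> V\<^sup>n) = (D X\<^sup>n, M X\<^sup>n) + \<delta> \<parallel>A\<^sub>\<tau> V\<^sup>n\<parallel>\<^sup>2\<close> (\<open>inner_A_P\<close>). Its left-hand side is what the dual norm
  measures. Two ingredients make the other side coercive.

  First, summation by parts (\<open>am_telescope\<close>) writes \<open>(dX\<^sup>n, M X\<^sup>n)\<close> as the increment of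
  \<open>\<parallel>X\<^sup>n\<parallel>\<^sup>2/2\<close> minus a form in differences, up to squares: \<open>-\<parallel>d\<^sup>2X\<^sup>n\<parallel>\<^sup>2/24\<close> for AM3, \<open>-\<parallel>d\<^sup>3X\<^sup>n\<parallel>\<^sup>2/48\<close> for
  AM4 and \<open>3\<parallel>d\<^sup>3X\<^sup>n\<parallel>\<^sup>2/160 - 19\<parallel>d\<^sup>4X\<^sup>n\<parallel>\<^sup>2/1440\<close> for AM5.

  Second, testing the \<open>k\<close>-th difference of the scheme with \<open>d\<^sup>k\<^sup>+\<^sup>1V\<^sup>n\<close> and using the inverse inequality
  shows that each difference gains a factor \<open>\<kappa> \<sim> \<tau>/h\<close>, up to residuals (\<open>incr_decay\<close>). Hence the form in
  differences is a small perturbation of \<open>\<parallel>X\<^sup>n\<parallel>\<^sup>2\<close>. The AM3 and AM4 defects are bounded by \<open>\<kappa>\<^sup>4\<close> and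
  \<open>\<kappa>\<^sup>6\<close> times \<open>\<Sum>\<^sub>n \<parallel>X\<^sup>n\<parallel>\<^sup>2\<close>, and the strengthened CFL conditions say precisely that these powers are at most
  a constant times \<open>\<tau>\<close>, so that a discrete Gronwall argument applies; the defects cannot be absorbed, which
  is the source of the exponential. For AM5 the fourth difference gains \<open>\<kappa>\<^sup>2\<close> over the third one and is absorbed
  by the dissipation, so no growth occurs.

  The first few differences of the scheme are not available near the starting values. There the
  solution is bounded by the data directly (\<open>start_bound\<close>). All of this uses only the
  recursive decay of differences and the energy balance, and is carried out for abstract sequences in
  \<open>energy_bound\<close>. The explicit constants are crude, but independent of all parameters.

  For \<open>\<delta> = b\<^sub>0\<tau>\<close> the form of the linear system is \<open>(T\<^sub>\<delta> U, T\<^sub>\<delta> W)/\<tau>\<close>, hence symmetric and positive definite.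
\<close>

section \<open>Summation by parts for the Adams--Moulton averages\<close>

text \<open>
  The average is the truncated series \<open>1 - d/2 - d\<^sup>2/12 - d\<^sup>3/24 - 19 d\<^sup>4/720\<close> in the backward
  difference \<open>d\<close>. Pairing it with \<open>dX\<close> and summing by parts, the term \<open>1 - d/2\<close> gives half the
  increment of \<open>\<parallel>X\<parallel>\<^sup>2\<close>, and every further term gives an increment of a quadratic form plus
  multiples of squared differences. For two steps the only square is \<open>-\<parallel>d\<^sup>2X\<parallel>\<^sup>2/24\<close>.
\<close>
lemma telescope_AM3:
  fixes X :: "nat \<Rightarrow> 'a::real_inner"
  assumes "2 \<le> n"
  defines "F \<equiv> \<lambda>n. (norm (X n))\<^sup>2 / 2 - (norm (incr 1 X n))\<^sup>2 / 24"
  shows "inner (incr 1 X n) (M_op 3 X n)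
    = F n - F (n - 1) - (norm (incr 2 X n))\<^sup>2 / 24"
proof -
  obtain k where n: "n = Suc (Suc k)"
    using le_Suc_ex[OF assms(1)] by (auto simp: numeral_eq_Suc)
  obtain a b c where X: "X k = a" "X (Suc k) = b" "X (Suc (Suc k)) = c"
    by blast
  have d: "incr 1 X n = (c - b)"
    "incr 2 X n = ((c - b) - (b - a))"
    "incr 1 X (n - 1) = (b - a)"
    by (simp_all add: n X numeral_eq_Suc)
  have m: "M_op 3 X n = (5/12) *\<^sub>R c + (2/3) *\<^sub>R b + (-1/12) *\<^sub>R a"
    by (simp add: M_op_def am_coeff_def n X numeral_eq_Suc)
  have x: "X n = c" "X (n - 1) = b"
    by (simp_all add: n X)
  show ?thesis
    unfolding F_def d m x
    by (simp add: power2_norm_eq_inner inner_diff_left inner_diff_right inner_add_left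
        inner_add_right inner_commute field_simps)
qed

text \<open>
  The additional term \<open>-d\<^sup>3/24\<close> contributes \<open>+\<parallel>d\<^sup>2X\<parallel>\<^sup>2/24\<close>, which cancels the AM3 defect exactly,
  and leaves a third difference; this is why AM4 tolerates the weaker CFL condition with exponent
  \<open>6/5\<close>.
\<close>
lemma telescope_AM4:
  fixes X :: "nat \<Rightarrow> 'a::real_inner"
  assumes "3 \<le> n"
  defines "F \<equiv> \<lambda>n. (norm (X n))\<^sup>2 / 2 - (norm (incr 1 X n))\<^sup>2 / 24
     - inner (incr 1 X n) (incr 2 X n) / 24 - (norm (incr 2 X n))\<^sup>2 / 48"
  shows "inner (incr 1 X n) (M_op 4 X n)
    = F n - F (n - 1) - (norm (incr 3 X n))\<^sup>2 / 48"
proof -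
  obtain k where n: "n = Suc (Suc (Suc k))"
    using le_Suc_ex[OF assms(1)] by (auto simp: numeral_eq_Suc)
  obtain a b c d where X: "X k = a" "X (Suc k) = b" "X (Suc (Suc k)) = c" "X (Suc (Suc (Suc k))) = d"
    by blast
  have d: "incr 1 X n = (d - c)"
    "incr 2 X n = ((d - c) - (c - b))"
    "incr 3 X n = (((d - c) - (c - b)) - ((c - b) - (b - a)))"
    "incr 1 X (n - 1) = (c - b)"
    "incr 2 X (n - 1) = ((c - b) - (b - a))"
    by (simp_all add: n X numeral_eq_Suc)
  have m: "M_op 4 X n = (3/8) *\<^sub>R d + (19/24) *\<^sub>R c + (-5/24) *\<^sub>R b + (1/24) *\<^sub>R a"
    by (simp add: M_op_def am_coeff_def n X numeral_eq_Suc)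
  have x: "X n = d" "X (n - 1) = c"
    by (simp_all add: n X)
  show ?thesis
    unfolding F_def d m x
    by (simp add: power2_norm_eq_inner inner_diff_left inner_diff_right inner_add_left
        inner_add_right inner_commute field_simps)
qed

text \<open>
  The fourth-order term turns the coefficient of \<open>\<parallel>d\<^sup>3X\<parallel>\<^sup>2\<close> from \<open>-1/48\<close> into
  \<open>-1/48 + 19/480 = 3/160\<close>: the method dissipates at low frequencies. At high frequencies the
  fourth difference wins, and it has to be dominated by means of the scheme itself.
\<close>
lemma telescope_AM5:
  fixes X :: "nat \<Rightarrow> 'a::real_inner"
  assumes "4 \<le> n"
  defines "F \<equiv> \<lambda>n. (norm (X n))\<^sup>2 / 2 - (norm (incr 1 X n))\<^sup>2 / 24
     - inner (incr 1 X n) (incr 2 X n) / 24 - (norm (incr 2 X n))\<^sup>2 / 48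
     - 19 / 720 * (inner (incr 1 X n) (incr 3 X n) - (norm (incr 2 X n))\<^sup>2 / 2
         + inner (incr 2 X n) (incr 3 X n) + (norm (incr 3 X n))\<^sup>2 / 2)"
  shows "inner (incr 1 X n) (M_op 5 X n)
    = F n - F (n - 1) + 3 / 160 * (norm (incr 3 X n))\<^sup>2 - 19 / 1440 * (norm (incr 4 X n))\<^sup>2"
proof -
  obtain k where n: "n = Suc (Suc (Suc (Suc k)))"
    using le_Suc_ex[OF assms(1)] by (auto simp: numeral_eq_Suc)
  obtain a b c d e where X: "X k = a" "X (Suc k) = b" "X (Suc (Suc k)) = c" "X (Suc (Suc (Suc k))) = d" "X (Suc (Suc (Suc (Suc k)))) = e"
    by blast
  have d: "incr 1 X n = (e - d)"
    "incr 2 X n = ((e - d) - (d - c))"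
    "incr 3 X n = (((e - d) - (d - c)) - ((d - c) - (c - b)))"
    "incr 4 X n = ((((e - d) - (d - c)) - ((d - c) - (c - b))) - (((d - c) - (c - b)) - ((c - b) - (b - a))))"
    "incr 1 X (n - 1) = (d - c)"
    "incr 2 X (n - 1) = ((d - c) - (c - b))"
    "incr 3 X (n - 1) = (((d - c) - (c - b)) - ((c - b) - (b - a)))"
    by (simp_all add: n X numeral_eq_Suc)
  have m: "M_op 5 X n = (251/720) *\<^sub>R e + (646/720) *\<^sub>R d + (-264/720) *\<^sub>R c + (106/720) *\<^sub>R b + (-19/720) *\<^sub>R a"
    by (simp add: M_op_def am_coeff_def n X numeral_eq_Suc)
  have x: "X n = e" "X (n - 1) = d"
    by (simp_all add: n X)
  show ?thesis
    unfolding F_def d m x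
    by (simp add: power2_norm_eq_inner inner_diff_left inner_diff_right inner_add_left
        inner_add_right inner_commute field_simps)
qed

text \<open>
  The part of the telescoping quadratic form that involves differences, for all three methods at
  once.
\<close>
definition am_correction :: "nat \<Rightarrow> (nat \<Rightarrow> 'a::real_inner) \<Rightarrow> nat \<Rightarrow> real" where
  "am_correction \<nu> X n = (norm (incr 1 X n))\<^sup>2 / 24
     + (if 4 \<le> \<nu> then inner (incr 1 X n) (incr 2 X n) / 24 + (norm (incr 2 X n))\<^sup>2 / 48 else 0)
     + (if \<nu> = 5 then 19 / 720 * (inner (incr 1 X n) (incr 3 X n) - (norm (incr 2 X n))\<^sup>2 / 2
         + inner (incr 2 X n) (incr 3 X n) + (norm (incr 3 X n))\<^sup>2 / 2) else 0)"

text \<open>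
  The non-telescoping part. For AM5 it is negative on slowly varying sequences.
\<close>
definition am_defect :: "nat \<Rightarrow> (nat \<Rightarrow> 'a::real_inner) \<Rightarrow> nat \<Rightarrow> real" where
  "am_defect \<nu> X n =
     (if \<nu> = 3 then (norm (incr 2 X n))\<^sup>2 / 24
      else if \<nu> = 4 then (norm (incr 3 X n))\<^sup>2 / 48
      else 19 / 1440 * (norm (incr 4 X n))\<^sup>2 - 3 / 160 * (norm (incr 3 X n))\<^sup>2)"

definition am_potential :: "nat \<Rightarrow> (nat \<Rightarrow> 'a::real_inner) \<Rightarrow> nat \<Rightarrow> real" where
  "am_potential \<nu> X n = (norm (X n))\<^sup>2 / 2 - am_correction \<nu> X n"

lemma am_telescope:
  assumes "\<nu> \<in> {3, 4, 5}" "n0 \<nu> \<le> n"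
  shows "inner (incr 1 X n) (M_op \<nu> X n)
    = am_potential \<nu> X n - am_potential \<nu> X (n - 1) - am_defect \<nu> X n"
proof -
  consider "\<nu> = 3" | "\<nu> = 4" | "\<nu> = 5"
    using assms(1) by blast
  then show ?thesis
  proof cases
    case 1
    then show ?thesis
      using assms(2) telescope_AM3[of n X]
      by (simp add: n0_def am_potential_def am_correction_def am_defect_def del: incr.simps)
  next
    case 2
    then show ?thesis
      using assms(2) telescope_AM4[of n X]
      by (simp add: n0_def am_potential_def am_correction_def am_defect_def del: incr.simps)
  next
    case 3
    then show ?thesis
      using assms(2) telescope_AM5[of n X]
      by (simp add: n0_def am_potential_def am_correction_def am_defect_def del: incr.simps)
  qed
qed

lemma sum_backward_diff:
  fixes f :: "nat \<Rightarrow> real"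
  assumes "1 \<le> a" "a \<le> m"
  shows "(\<Sum>n=a..m. f n - f (n - 1)) = f m - f (a - 1)"
  using assms(2) by (induction rule: dec_induct) auto

lemma sum_am_telescope:
  assumes "\<nu> \<in> {3, 4, 5}" "n0 \<nu> \<le> m"
  shows "(\<Sum>n=n0 \<nu>..m. inner (incr 1 X n) (M_op \<nu> X n))
    = am_potential \<nu> X m - am_potential \<nu> X (n0 \<nu> - 1) - (\<Sum>n=n0 \<nu>..m. am_defect \<nu> X n)"
proof -
  have "(\<Sum>n=n0 \<nu>..m. inner (incr 1 X n) (M_op \<nu> X n))
      = (\<Sum>n=n0 \<nu>..m. (am_potential \<nu> X n - am_potential \<nu> X (n - 1)) - am_defect \<nu> X n)"
    using assms(1) by (intro sum.cong refl am_telescope) auto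
  also have "\<dots> = (am_potential \<nu> X m - am_potential \<nu> X (n0 \<nu> - 1)) - (\<Sum>n=n0 \<nu>..m. am_defect \<nu> X n)"
    using assms by (subst sum_subtractf, subst sum_backward_diff) (auto simp: n0_def)
  finally show ?thesis .
qed

section \<open>Averages and differences of sequences\<close>

lemma abs_am_coeff_le_1: "\<nu> \<in> {3, 4, 5} \<Longrightarrow> j < \<nu> \<Longrightarrow> \<bar>am_coeff \<nu> j\<bar> \<le> 1"
  by (auto simp: am_coeff_def numeral_eq_Suc less_Suc_eq)

lemma norm_M_op_le:
  fixes Y :: "nat \<Rightarrow> 'a::real_normed_vector"
  assumes "\<nu> \<in> {3, 4, 5}"
  shows "norm (M_op \<nu> Y n) \<le> (\<Sum>j<\<nu>. norm (Y (n - j)))"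
  unfolding M_op_def
proof (rule order_trans[OF norm_sum sum_mono])
  fix j assume "j \<in> {..<\<nu>}"
  then show "norm (am_coeff \<nu> j *\<^sub>R Y (n - j)) \<le> norm (Y (n - j))"
    using abs_am_coeff_le_1[OF assms, of j] by (simp add: mult_left_le_one_le)
qed

lemma norm_M_op_sq_le:
  fixes Y :: "nat \<Rightarrow> 'a::real_normed_vector"
  assumes "\<nu> \<in> {3, 4, 5}"
  shows "(norm (M_op \<nu> Y n))\<^sup>2 \<le> 5 * (\<Sum>j<\<nu>. (norm (Y (n - j)))\<^sup>2)"
proof -
  have "(norm (M_op \<nu> Y n))\<^sup>2 \<le> (\<Sum>j<\<nu>. norm (Y (n - j)))\<^sup>2"
    by (intro power_mono norm_M_op_le assms norm_ge_zero)
  also have "\<dots> \<le> (\<Sum>j<\<nu>. (norm (Y (n - j)))\<^sup>2) * real \<nu>"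
    using sum_squared_le_sum_of_squares[of "\<lambda>j. norm (Y (n - j))" "{..<\<nu>}"] by simp
  also have "\<dots> \<le> (\<Sum>j<\<nu>. (norm (Y (n - j)))\<^sup>2) * 5"
    using assms by (intro mult_left_mono sum_nonneg) auto
  finally show ?thesis
    by (simp add: mult.commute)
qed

lemma norm_incr_le:
  fixes X :: "nat \<Rightarrow> 'a::real_normed_vector"
  assumes "\<And>i. i \<le> n \<Longrightarrow> norm (X i) \<le> c"
  shows "norm (incr k X n) \<le> 2 ^ k * c"
  using assms
proof (induction k arbitrary: n)
  case (Suc k)
  have "norm (incr k X n) \<le> 2 ^ k * c" "norm (incr k X (n - 1)) \<le> 2 ^ k * c"
    using Suc.prems by (auto intro!: Suc.IH)
  then show ?case
    using norm_triangle_ineq4[of "incr k X n" "incr k X (n - 1)"] by simp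
qed simp

lemma norm_diff_sq_le:
  fixes x y :: "'a::real_normed_vector"
  shows "(norm (x - y))\<^sup>2 \<le> 2 * (norm x)\<^sup>2 + 2 * (norm y)\<^sup>2"
proof -
  have "(norm (x - y))\<^sup>2 \<le> (norm x + norm y)\<^sup>2"
    by (intro power_mono norm_triangle_ineq4) auto
  also have "\<dots> \<le> 2 * (norm x)\<^sup>2 + 2 * (norm y)\<^sup>2"
    using sum_squares_bound[of "norm x" "norm y"] by (simp add: power2_sum)
  finally show ?thesis .
qed

lemma sum_backshift_le:
  fixes f :: "nat \<Rightarrow> real"
  assumes "\<And>i. 0 \<le> f i" "j + a \<le> b"
  shows "(\<Sum>n=b..m. f (n - j)) \<le> (\<Sum>n=a..m. f n)"
proof -
  have "(\<Sum>n=b..m. f (n - j)) = sum f ((\<lambda>n. n - j) ` {b..m})"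
    using assms(2) by (subst sum.reindex) (auto simp: inj_on_def o_def)
  also have "\<dots> \<le> (\<Sum>n=a..m. f n)"
    using assms by (intro sum_mono2) auto
  finally show ?thesis .
qed

lemma sum_incr_sq_le:
  fixes y :: "nat \<Rightarrow> 'a::real_normed_vector"
  shows "(\<Sum>n=a+k..m. (norm (incr k y n))\<^sup>2) \<le> 4 ^ k * (\<Sum>n=a..m. (norm (y n))\<^sup>2)"
proof (induction k)
  case (Suc k)
  have "(\<Sum>n=a+Suc k..m. (norm (incr (Suc k) y n))\<^sup>2)
      \<le> (\<Sum>n=a+Suc k..m. 2 * (norm (incr k y n))\<^sup>2 + 2 * (norm (incr k y (n - 1)))\<^sup>2)"
    by (intro sum_mono) (simp add: norm_diff_sq_le)
  also have "\<dots> = 2 * (\<Sum>n=a+Suc k..m. (norm (incr k y n))\<^sup>2)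
      + 2 * (\<Sum>n=a+Suc k..m. (norm (incr k y (n - 1)))\<^sup>2)"
    by (simp only: sum.distrib sum_distrib_left)
  also have "\<dots> \<le> 2 * (\<Sum>n=a+k..m. (norm (incr k y n))\<^sup>2) + 2 * (\<Sum>n=a+k..m. (norm (incr k y n))\<^sup>2)"
    using sum_backshift_le[of "\<lambda>n. (norm (incr k y n))\<^sup>2" 1 "a + k" "a + Suc k" m]
    by (intro add_mono mult_left_mono) (auto intro!: sum_mono2)
  also have "\<dots> \<le> 4 ^ Suc k * (\<Sum>n=a..m. (norm (y n))\<^sup>2)"
    using Suc.IH by simp
  finally show ?case .
qed simp

text \<open>
  The sum excludes \<open>u i\<close> itself, so that an implicit contribution has to be absorbed beforehand.
\<close>
lemma discrete_gronwall:
  fixes u :: "nat \<Rightarrow> real"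
  assumes "\<And>i. i \<le> k \<Longrightarrow> u i \<le> c + a * (\<Sum>j<i. u j)" "0 \<le> a" "0 \<le> c"
  shows "u k \<le> c * exp (a * real k)"
proof -
  have "c + a * (\<Sum>j<i. u j) \<le> c * (1 + a) ^ i" if "i \<le> k" for i
    using that
  proof (induction i)
    case (Suc i)
    have "u i \<le> c * (1 + a) ^ i"
      using assms(1)[of i] Suc by linarith
    then have "a * u i \<le> a * (c * (1 + a) ^ i)"
      using assms(2) by (rule mult_left_mono)
    then show ?case
      using Suc by (simp add: algebra_simps)
  qed simp
  then have "u k \<le> c * (1 + a) ^ k"
    using assms(1)[of k] by force
  also have "\<dots> \<le> c * exp a ^ k"
    using assms by (intro mult_left_mono power_mono exp_ge_add_one_self) auto
  finally show ?thesis
    by (metis exp_of_nat_mult mult.commute)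
qed

section \<open>Decay of differences\<close>

text \<open>
  What the scheme says about the sequence \<open>X = T\<^sub>\<delta> V\<close> once it is tested with differences of \<open>V\<close>:
  each difference is smaller than the preceding one by a factor \<open>\<kappa>\<close>, a multiple of \<open>\<tau>/h\<close>, up
  to the residual \<open>r\<close>, a multiple of \<open>\<tau>R\<close>. The \<open>k\<close>-th difference of the scheme is available only
  once all the indices involved are computed ones, whence \<open>n0 \<nu> + k \<le> n\<close>. The threshold on \<open>\<kappa>\<close>
  is a convenient one.
\<close>
locale AM_recursion =
  fixes \<nu> :: nat and X r :: "nat \<Rightarrow> 'a::real_inner" and \<kappa> :: real and N :: nat
  assumes order: "\<nu> \<in> {3, 4, 5}"
    and kappa_nonneg: "0 \<le> \<kappa>" and kappa_small: "\<kappa> \<le> 1 / 1000"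
    and recursion: "\<And>k n. n0 \<nu> + k \<le> n \<Longrightarrow> n \<le> N \<Longrightarrow>
      norm (incr (Suc k) X n) \<le> \<kappa> * norm (M_op \<nu> (incr k X) n) + norm (incr k r n)"
begin

definition data :: real where
  "data = (\<Sum>j<n0 \<nu>. (norm (X j))\<^sup>2) + (\<Sum>n=n0 \<nu>..N. (norm (r n))\<^sup>2)"

definition sumsq :: "nat \<Rightarrow> nat \<Rightarrow> real" where
  "sumsq k m = (\<Sum>n=k..m. (norm (incr k X n))\<^sup>2)"

lemma data_nonneg: "0 \<le> data"
  by (simp add: data_def sum_nonneg)

lemma n0_bounds: "\<nu> = Suc (n0 \<nu>)" "2 \<le> n0 \<nu>" "n0 \<nu> \<le> 4"
  using order by (auto simp: n0_def)

lemma initial_le_data: "j < n0 \<nu> \<Longrightarrow> (norm (X j))\<^sup>2 \<le> data"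
proof -
  assume "j < n0 \<nu>"
  then have "(norm (X j))\<^sup>2 \<le> (\<Sum>j<n0 \<nu>. (norm (X j))\<^sup>2)"
    by (intro member_le_sum) auto
  also have "\<dots> \<le> data"
    by (simp add: data_def sum_nonneg)
  finally show ?thesis .
qed

lemma residual_le_data: "n0 \<nu> \<le> n \<Longrightarrow> n \<le> N \<Longrightarrow> (norm (r n))\<^sup>2 \<le> data"
proof -
  assume "n0 \<nu> \<le> n" "n \<le> N"
  then have "(norm (r n))\<^sup>2 \<le> (\<Sum>n=n0 \<nu>..N. (norm (r n))\<^sup>2)"
    by (intro member_le_sum) auto
  also have "\<dots> \<le> data"
    by (simp add: data_def sum_nonneg)
  finally show ?thesis .
qed

text \<open>
  Bounds the first few computed values by the data. As \<open>\<kappa>\<close> is small the implicit term can be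
  absorbed, which leaves \<open>\<parallel>X\<^sup>n\<parallel> \<le> 4 \<Sum>\<^sub>i\<^sub><\<^sub>n \<parallel>X\<^sup>i\<parallel> + 2 data\<^sup>1\<^sup>/\<^sup>2\<close>, and \<open>2 \<cdot> 5\<^sup>n\<close> solves this recursion. The
  exponential growth is harmless because only \<open>n \<le> 6\<close> will be used.
\<close>
lemma start_bound: "n \<le> N \<Longrightarrow> norm (X n) \<le> 2 * 5 ^ n * sqrt data"
proof (induction n rule: less_induct)
  case (less n)
  show ?case
  proof (cases "n < n0 \<nu>")
    case True
    then have "norm (X n) \<le> sqrt data"
      using initial_le_data real_le_rsqrt by blast
    moreover have "1 * sqrt data \<le> 2 * 5 ^ n * sqrt data"
      using data_nonneg one_le_power[of "5::real" n]
      by (intro mult_right_mono) (linarith, simp)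
    ultimately show ?thesis
      by linarith
  next
    case False
    define s where "s = (\<Sum>i<n. norm (X i))"
    have "1 \<le> n"
      using False n0_bounds by linarith
    have "norm (M_op \<nu> X n) \<le> (\<Sum>j<\<nu>. norm (X (n - j)))"
      by (rule norm_M_op_le[OF order])
    also have "\<dots> = sum (\<lambda>i. norm (X i)) ((\<lambda>j. n - j) ` {..<\<nu>})"
      using False n0_bounds by (subst sum.reindex) (auto simp: inj_on_def o_def)
    also have "\<dots> \<le> sum (\<lambda>i. norm (X i)) {..<Suc n}"
      by (intro sum_mono2) auto
    finally have M: "norm (M_op \<nu> X n) \<le> s + norm (X n)"
      by (simp add: s_def)
    have "norm (incr (Suc 0) X n) \<le> \<kappa> * norm (M_op \<nu> (incr 0 X) n) + norm (incr 0 r n)"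
      using False less.prems by (intro recursion) auto
    moreover have "norm (X n) \<le> norm (incr (Suc 0) X n) + norm (X (n - 1))"
      using norm_triangle_sub[of "X n" "X (n - 1)"] by simp
    moreover have "\<kappa> * norm (M_op \<nu> X n) \<le> 1 / 1000 * (s + norm (X n))"
      using M kappa_nonneg kappa_small by (intro mult_mono) auto
    moreover have "norm (X (n - 1)) \<le> s"
      unfolding s_def using \<open>1 \<le> n\<close> by (intro member_le_sum) auto
    moreover have "norm (r n) \<le> sqrt data"
      using residual_le_data[of n] False less.prems by (intro real_le_rsqrt) auto
    moreover have "0 \<le> s" "0 \<le> sqrt data"
      using data_nonneg by (simp_all add: s_def sum_nonneg)
    moreover have "incr 0 X = X"
      by auto
    ultimately have "norm (X n) \<le> 4 * s + 2 * sqrt data"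
      by (simp del: real_sqrt_ge_0_iff)
    also have "s \<le> (\<Sum>i<n. 2 * 5 ^ i * sqrt data)"
      unfolding s_def using less by (intro sum_mono) auto
    also have "\<dots> = (\<Sum>i<n. 5 ^ i) * 2 * sqrt data"
      unfolding sum_distrib_right by (intro sum.cong) auto
    also have "(\<Sum>i<n. 5 ^ i) = ((5::real) ^ n - 1) / 4"
      by (simp add: geometric_sum)
    finally show ?thesis
      by (simp add: field_simps)
  qed
qed

text \<open>
  The indices \<open>n < n0 \<nu> + k\<close>, where the \<open>k\<close>-th difference of the scheme is not yet available, satisfy
  \<open>n \<le> 6\<close> for \<open>k \<le> 3\<close>. The constant exceeds \<open>(2\<^sup>4 \<cdot> 2 \<cdot> 5\<^sup>6)\<^sup>2\<close>.
\<close>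
lemma startup_incr_sq_le:
  assumes "k \<le> 4" "n \<le> 6" "n \<le> N"
  shows "(norm (incr k X n))\<^sup>2 \<le> 300000000000 * data"
proof -
  have "norm (X i) \<le> 31250 * sqrt data" if "i \<le> n" for i
  proof -
    have "(5::real) ^ i \<le> 5 ^ 6"
      using that assms by (intro power_increasing) auto
    then have "2 * 5 ^ i * sqrt data \<le> 31250 * sqrt data"
      using data_nonneg by (intro mult_right_mono) auto
    then show ?thesis
      using start_bound[of i] that assms by linarith
  qed
  then have "norm (incr k X n) \<le> 2 ^ k * (31250 * sqrt data)"
    by (rule norm_incr_le)
  also have "\<dots> \<le> 2 ^ 4 * (31250 * sqrt data)"
    using assms data_nonneg by (intro mult_right_mono power_increasing) auto
  finally have "(norm (incr k X n))\<^sup>2 \<le> (2 ^ 4 * (31250 * sqrt data))\<^sup>2"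
    by (intro power_mono) auto
  also have "\<dots> = 250000000000 * data"
    using data_nonneg by (simp add: power_mult_distrib)
  finally show ?thesis
    using data_nonneg by linarith
qed

lemma recursion_sq:
  assumes "n0 \<nu> + k \<le> n" "n \<le> N"
  shows "(norm (incr (Suc k) X n))\<^sup>2
    \<le> 10 * \<kappa>\<^sup>2 * (\<Sum>j<\<nu>. (norm (incr k X (n - j)))\<^sup>2) + 2 * (norm (incr k r n))\<^sup>2"
proof -
  let ?M = "norm (M_op \<nu> (incr k X) n)"
  have "(norm (incr (Suc k) X n))\<^sup>2 \<le> (\<kappa> * ?M + norm (incr k r n))\<^sup>2"
    by (intro power_mono recursion assms norm_ge_zero)
  also have "\<dots> \<le> 2 * \<kappa>\<^sup>2 * ?M\<^sup>2 + 2 * (norm (incr k r n))\<^sup>2"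
    using sum_squares_bound[of "\<kappa> * ?M" "norm (incr k r n)"]
    by (simp add: power2_sum power_mult_distrib)
  also have "2 * \<kappa>\<^sup>2 * ?M\<^sup>2 \<le> 2 * \<kappa>\<^sup>2 * (5 * (\<Sum>j<\<nu>. (norm (incr k X (n - j)))\<^sup>2))"
    by (intro mult_left_mono norm_M_op_sq_le order) auto
  finally show ?thesis
    by (simp add: algebra_simps)
qed

text \<open>
  The gain of \<open>\<kappa>\<^sup>2\<close> per difference. At most three indices precede \<open>n0 \<nu> + k\<close> and are estimated by the
  data alone. For the others the scheme is used; an average of width \<open>\<nu>\<close> ending at
  \<open>n \<ge> n0 \<nu> + k\<close> reaches back to \<open>k\<close> at the earliest, exactly where \<open>sumsq k m\<close> starts.
\<close>
lemma sumsq_Suc_le: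
  assumes "k \<le> 3" "m \<le> N"
  shows "sumsq (Suc k) m \<le> 2000000000000 * data + 50 * \<kappa>\<^sup>2 * sumsq k m"
proof -
  let ?f = "\<lambda>n. (norm (incr (Suc k) X n))\<^sup>2"
  have "sumsq (Suc k) m \<le> sum ?f ({Suc k..<n0 \<nu> + k} \<inter> {..m} \<union> {n0 \<nu> + k..m})"
    unfolding sumsq_def by (intro sum_mono2) auto
  also have "\<dots> \<le> sum ?f ({Suc k..<n0 \<nu> + k} \<inter> {..m}) + sum ?f {n0 \<nu> + k..m}"
    by (subst sum.union_disjoint) auto
  also have "sum ?f ({Suc k..<n0 \<nu> + k} \<inter> {..m})
      \<le> real (card ({Suc k..<n0 \<nu> + k} \<inter> {..m})) * (300000000000 * data)"
    using assms n0_bounds by (intro sum_bounded_above startup_incr_sq_le) auto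
  also have "\<dots> \<le> 3 * (300000000000 * data)"
  proof (intro mult_right_mono)
    have "card ({Suc k..<n0 \<nu> + k} \<inter> {..m}) \<le> card {Suc k..<n0 \<nu> + k}"
      by (intro card_mono) auto
    then show "real (card ({Suc k..<n0 \<nu> + k} \<inter> {..m})) \<le> 3"
      using n0_bounds by simp
  qed (use data_nonneg in auto)
  also have "sum ?f {n0 \<nu> + k..m} \<le> (\<Sum>n=n0 \<nu> + k..m.
      10 * \<kappa>\<^sup>2 * (\<Sum>j<\<nu>. (norm (incr k X (n - j)))\<^sup>2) + 2 * (norm (incr k r n))\<^sup>2)"
    using assms by (intro sum_mono recursion_sq) auto
  also have "\<dots> = 10 * \<kappa>\<^sup>2 * (\<Sum>j<\<nu>. \<Sum>n=n0 \<nu> + k..m. (norm (incr k X (n - j)))\<^sup>2)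
      + 2 * (\<Sum>n=n0 \<nu> + k..m. (norm (incr k r n))\<^sup>2)"
    by (subst sum.swap) (simp only: sum.distrib sum_distrib_left)
  also have "(\<Sum>j<\<nu>. \<Sum>n=n0 \<nu> + k..m. (norm (incr k X (n - j)))\<^sup>2) \<le> (\<Sum>j<\<nu>. sumsq k m)"
    unfolding sumsq_def
    by (intro sum_mono sum_backshift_le) (use n0_bounds in auto)
  also have "\<dots> \<le> 5 * sumsq k m"
    using order by (auto simp: sumsq_def intro!: mult_right_mono sum_nonneg)
  also have "(\<Sum>n=n0 \<nu> + k..m. (norm (incr k r n))\<^sup>2) \<le> 4 ^ k * (\<Sum>n=n0 \<nu>..m. (norm (r n))\<^sup>2)"
    by (rule sum_incr_sq_le)
  also have "\<dots> \<le> 4 ^ 3 * data"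
  proof (intro mult_mono)
    have "(\<Sum>n=n0 \<nu>..m. (norm (r n))\<^sup>2) \<le> (\<Sum>n=n0 \<nu>..N. (norm (r n))\<^sup>2)"
      using assms by (intro sum_mono2) auto
    then show "(\<Sum>n=n0 \<nu>..m. (norm (r n))\<^sup>2) \<le> data"
      unfolding data_def by (simp add: add_increasing sum_nonneg)
    show "4 ^ k \<le> (4::real) ^ 3"
      using assms by (intro power_increasing) auto
  qed (auto intro!: sum_nonneg)
  finally show ?thesis
    using data_nonneg by (simp add: mult_right_mono algebra_simps)
qed

end

section \<open>The energy estimate\<close>

lemma abs_inner_le_mean_square:
  fixes x y :: "'a::real_inner"
  shows "\<bar>inner x y\<bar> \<le> ((norm x)\<^sup>2 + (norm y)\<^sup>2) / 2"
  using Cauchy_Schwarz_ineq2[of x y] sum_squares_bound[of "norm x" "norm y"] by simp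

lemma incr_two_three:
  "incr 2 X n = incr 1 X n - incr 1 X (n - 1)"
  "incr 3 X n = incr 2 X n - incr 2 X (n - 1)"
  by (simp_all add: numeral_2_eq_2 numeral_3_eq_3)

text \<open>
  The form contains first, second and third differences up to the index \<open>n\<close>, and higher differences
  are controlled by first ones. The assumption \<open>n0 \<nu> \<le> Suc n\<close> ensures that no first difference
  before index \<open>1\<close> is met.
\<close>
lemma abs_am_correction_le:
  fixes X :: "nat \<Rightarrow> 'a::real_inner"
  assumes "\<nu> \<in> {3, 4, 5}" "n0 \<nu> \<le> Suc n"
    and A: "\<And>i. 1 \<le> i \<Longrightarrow> i \<le> n \<Longrightarrow> (norm (incr 1 X i))\<^sup>2 \<le> A"
  shows "\<bar>am_correction \<nu> X n\<bar> \<le> A"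
proof -
  have d2: "(norm (incr 2 X i))\<^sup>2 \<le> 4 * A" if "2 \<le> i" "i \<le> n" for i
  proof -
    have "(norm (incr 1 X i))\<^sup>2 \<le> A" "(norm (incr 1 X (i - 1)))\<^sup>2 \<le> A"
      using that by - (intro A; simp)+
    then show ?thesis
      unfolding incr_two_three using norm_diff_sq_le[of "incr 1 X i" "incr 1 X (i - 1)"] by linarith
  qed
  have d3: "(norm (incr 3 X n))\<^sup>2 \<le> 16 * A" if "3 \<le> n"
  proof -
    have "(norm (incr 2 X n))\<^sup>2 \<le> 4 * A" "(norm (incr 2 X (n - 1)))\<^sup>2 \<le> 4 * A"
      using that by - (intro d2; simp)+
    then show ?thesis
      unfolding incr_two_three(2) using norm_diff_sq_le[of "incr 2 X n" "incr 2 X (n - 1)"] by linarith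
  qed
  have A0: "(norm (incr 1 X n))\<^sup>2 \<le> A"
    using A[of n] assms by (auto simp: n0_def)
  note i = abs_inner_le_mean_square[of "incr 1 X n" "incr 2 X n"] abs_inner_le_mean_square[of "incr 1 X n" "incr 3 X n"]
    abs_inner_le_mean_square[of "incr 2 X n" "incr 3 X n"]
  have nn: "0 \<le> (norm (incr k X n))\<^sup>2" for k
    by simp
  consider "\<nu> = 3" | "\<nu> = 4" "2 \<le> n" | "\<nu> = 5" "3 \<le> n"
    using assms(1,2) by (auto simp: n0_def)
  then show ?thesis
  proof cases
    case 1
    then show ?thesis
      using A0 order_trans[OF nn A0] by (simp add: am_correction_def del: incr.simps)
  next
    case 2
    then show ?thesis
      using A0 d2[of n] nn[of 1] nn[of 2] i(1) unfolding am_correction_def abs_le_iff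
      by (simp del: incr.simps)
  next
    case 3
    then show ?thesis
      using A0 d2[of n] d3 nn[of 1] nn[of 2] nn[of 3] i unfolding am_correction_def abs_le_iff
      by (simp del: incr.simps add: field_simps)
  qed
qed

context AM_recursion
begin

definition initial :: real where
  "initial = (\<Sum>j<n0 \<nu>. (norm (X j))\<^sup>2)"

text \<open>
  The factor with which the AM3 and AM4 defects, second and third differences, are bounded by the
  undifferenced sequence.
\<close>
definition growth_rate :: real where
  "growth_rate = (if \<nu> = 3 then \<kappa> ^ 4 else if \<nu> = 4 then \<kappa> ^ 6 else 0)"

definition am5_dissipation :: "nat \<Rightarrow> real" where
  "am5_dissipation m = (if \<nu> = 5 then (\<Sum>n=4..<m. (norm (incr 3 X n))\<^sup>2) else 0)"

lemma am5_dissipation_nonneg: "0 \<le> am5_dissipation m"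
  by (simp add: am5_dissipation_def sum_nonneg)

text \<open>
  The function \<open>q\<close> stands for the dissipation \<open>\<tau>\<delta>\<parallel>A\<^sub>\<tau>V\<^sup>n\<parallel>\<^sup>2\<close>.
\<close>
definition energy :: "(nat \<Rightarrow> real) \<Rightarrow> nat \<Rightarrow> real" where
  "energy q m = Max ((\<lambda>n. (norm (X n))\<^sup>2) ` {n0 \<nu>..m}) + (\<Sum>n=n0 \<nu>..m. q n)
     + am5_dissipation m"

lemma kappa_sq_small: "\<kappa>\<^sup>2 \<le> 1 / 1000000"
  using power_mono[OF kappa_small kappa_nonneg, of 2] by (simp add: power_divide)

lemma growth_rate_bounds: "0 \<le> growth_rate" "growth_rate \<le> 1 / 1000000000000"
proof -
  have "\<kappa> ^ 4 \<le> (1 / 1000) ^ 4" "\<kappa> ^ 6 \<le> (1 / 1000) ^ 6"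
    using kappa_nonneg kappa_small by (auto intro: power_mono)
  then show "0 \<le> growth_rate" "growth_rate \<le> 1 / 1000000000000"
    using kappa_nonneg by (auto simp: growth_rate_def power_divide)
qed

lemma initial_bounds: "0 \<le> initial" "initial \<le> data"
  by (auto simp: initial_def data_def sum_nonneg)

lemma sumsq_nonneg: "0 \<le> sumsq k m"
  by (simp add: sumsq_def sum_nonneg)

lemma sumsq_2_le:
  assumes "m \<le> N"
  shows "sumsq 2 m \<le> 4000000000000 * data + 2500 * \<kappa> ^ 4 * sumsq 0 m"
proof -
  have "50 * \<kappa>\<^sup>2 * sumsq 1 m \<le> 50 * \<kappa>\<^sup>2 * (2000000000000 * data + 50 * \<kappa>\<^sup>2 * sumsq 0 m)"
    using sumsq_Suc_le[of 0 m] assms by (intro mult_left_mono) auto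
  also have "\<dots> = 50 * \<kappa>\<^sup>2 * (2000000000000 * data) + 2500 * \<kappa> ^ 4 * sumsq 0 m"
    by (simp add: algebra_simps power4_eq_xxxx power2_eq_square)
  also have "50 * \<kappa>\<^sup>2 * (2000000000000 * data) \<le> 1 * (2000000000000 * data)"
    using kappa_sq_small data_nonneg by (intro mult_right_mono) auto
  finally show ?thesis
    using sumsq_Suc_le[of 1 m] assms by (simp add: numeral_2_eq_2)
qed

lemma sumsq_3_le:
  assumes "m \<le> N"
  shows "sumsq 3 m \<le> 6000000000000 * data + 125000 * \<kappa> ^ 6 * sumsq 0 m"
proof -
  have "50 * \<kappa>\<^sup>2 * sumsq 2 m \<le> 50 * \<kappa>\<^sup>2 * (4000000000000 * data + 2500 * \<kappa> ^ 4 * sumsq 0 m)"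
    using sumsq_2_le[of m] assms by (intro mult_left_mono) auto
  also have "\<dots> = 50 * \<kappa>\<^sup>2 * (4000000000000 * data) + 125000 * \<kappa> ^ 6 * sumsq 0 m"
    by (simp add: algebra_simps eval_nat_numeral)
  also have "50 * \<kappa>\<^sup>2 * (4000000000000 * data) \<le> 1 * (4000000000000 * data)"
    using kappa_sq_small data_nonneg by (intro mult_right_mono) auto
  finally show ?thesis
    using sumsq_Suc_le[of 2 m] assms by (simp add: numeral_3_eq_3 numeral_2_eq_2)
qed

text \<open>
  For AM3 and AM4 the defect is a difference that gains \<open>\<kappa>\<^sup>4\<close> or \<open>\<kappa>\<^sup>6\<close>. For AM5 the sum of the fourth
  differences gains \<open>\<kappa>\<^sup>2\<close> over that of the third ones and is absorbed by the coefficient \<open>3/160\<close>; this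
  leaves a dissipation and no growth.
\<close>
lemma sum_am_defect_le:
  assumes "n0 \<nu> \<le> m" "m \<le> N"
  shows "(\<Sum>n=n0 \<nu>..m. am_defect \<nu> X n) \<le> 10000000000000 * data + 125000 * growth_rate * sumsq 0 m
    - am5_dissipation m / 160"
proof -
  consider "\<nu> = 3" | "\<nu> = 4" | "\<nu> = 5"
    using order by blast
  then show ?thesis
  proof cases
    case 1
    then have gr: "growth_rate = \<kappa> ^ 4" and ne: "am5_dissipation m = 0"
      unfolding growth_rate_def am5_dissipation_def by simp_all
    from 1 have "(\<Sum>n=n0 \<nu>..m. am_defect \<nu> X n) = sumsq 2 m / 24"
      by (simp add: am_defect_def sumsq_def n0_def sum_divide_distrib del: incr.simps)
    moreover have "0 \<le> \<kappa> ^ 4 * sumsq 0 m"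
      using sumsq_nonneg by simp
    ultimately show ?thesis
      using sumsq_2_le[OF assms(2)] data_nonneg gr ne by simp
  next
    case 2
    then have gr: "growth_rate = \<kappa> ^ 6" and ne: "am5_dissipation m = 0"
      unfolding growth_rate_def am5_dissipation_def by simp_all
    from 2 have "(\<Sum>n=n0 \<nu>..m. am_defect \<nu> X n) = sumsq 3 m / 48"
      by (simp add: am_defect_def sumsq_def n0_def sum_divide_distrib del: incr.simps)
    moreover have "0 \<le> \<kappa> ^ 6 * sumsq 0 m"
      using sumsq_nonneg by simp
    ultimately show ?thesis
      using sumsq_3_le[OF assms(2)] data_nonneg gr ne by simp
  next
    case 3
    define g where "g = (\<Sum>n=4..m. (norm (incr 3 X n))\<^sup>2)"
    have ex: "am5_dissipation m = (\<Sum>n=4..<m. (norm (incr 3 X n))\<^sup>2)"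
      using 3 unfolding am5_dissipation_def by simp
    have gr: "0 \<le> growth_rate * sumsq 0 m"
      using growth_rate_bounds sumsq_nonneg by simp
    have m: "4 \<le> m"
      using assms 3 by (simp add: n0_def)
    have "(\<Sum>n=n0 \<nu>..m. am_defect \<nu> X n) = 19 / 1440 * sumsq 4 m - 3 / 160 * g"
      using 3 by (simp add: am_defect_def sumsq_def g_def n0_def sum_subtractf sum_distrib_left del: incr.simps)
    moreover have "sumsq 3 m = (norm (incr 3 X 3))\<^sup>2 + g"
      using m by (simp add: sumsq_def g_def sum.atLeast_Suc_atMost del: incr.simps)
    moreover have "(norm (incr 3 X 3))\<^sup>2 \<le> 300000000000 * data"
      using m assms by (intro startup_incr_sq_le) auto
    moreover have "sumsq 4 m \<le> 2000000000000 * data + 50 * \<kappa>\<^sup>2 * sumsq 3 m"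
      using sumsq_Suc_le[of 3 m] assms by (simp add: eval_nat_numeral)
    moreover have "\<kappa>\<^sup>2 * sumsq 3 m \<le> 1 / 1000000 * sumsq 3 m"
      by (intro mult_right_mono kappa_sq_small sumsq_nonneg)
    moreover have "(\<Sum>n=4..<m. (norm (incr 3 X n))\<^sup>2) \<le> g"
      unfolding g_def by (intro sum_mono2) auto
    moreover have "0 \<le> g"
      by (simp add: g_def sum_nonneg)
    ultimately show ?thesis
      unfolding ex using data_nonneg gr by linarith
  qed
qed

text \<open>
  Makes the boundary terms of the summation by parts small relative to the energy.
\<close>
lemma first_incr_sq_le:
  assumes "1 \<le> n" "n \<le> N" and E: "\<And>i. i \<le> n \<Longrightarrow> (norm (X i))\<^sup>2 \<le> E"
  shows "(norm (incr 1 X n))\<^sup>2 \<le> 50 * \<kappa>\<^sup>2 * E + 4 * data"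
proof (cases "n < n0 \<nu>")
  case True
  have "0 \<le> E"
    using E[of 0] zero_le_power2[of "norm (X 0)"] by linarith
  then have "0 \<le> 50 * \<kappa>\<^sup>2 * E"
    by simp
  moreover have "(norm (incr 1 X n))\<^sup>2 \<le> 4 * data"
    using norm_diff_sq_le[of "X n" "X (n - 1)"] initial_le_data[of n] initial_le_data[of "n - 1"]
      True less_imp_diff_less[OF True, of 1] by simp
  ultimately show ?thesis
    by linarith
next
  case False
  have "(norm (incr 1 X n))\<^sup>2
      \<le> 10 * \<kappa>\<^sup>2 * (\<Sum>j<\<nu>. (norm (X (n - j)))\<^sup>2) + 2 * (norm (r n))\<^sup>2"
    using False assms recursion_sq[of 0 n] by simp
  moreover have "10 * \<kappa>\<^sup>2 * (\<Sum>j<\<nu>. (norm (X (n - j)))\<^sup>2) \<le> 10 * \<kappa>\<^sup>2 * (5 * E)"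
  proof (intro mult_left_mono)
    have "0 \<le> E"
      using E[of 0] zero_le_power2[of "norm (X 0)"] by linarith
    then have "real \<nu> * E \<le> 5 * E"
      using order by (intro mult_right_mono) auto
    moreover have "(\<Sum>j<\<nu>. (norm (X (n - j)))\<^sup>2) \<le> real (card {..<\<nu>}) * E"
      by (intro sum_bounded_above E) auto
    ultimately show "(\<Sum>j<\<nu>. (norm (X (n - j)))\<^sup>2) \<le> 5 * E"
      by simp
  qed auto
  moreover have "(norm (r n))\<^sup>2 \<le> data"
    using False assms by (intro residual_le_data) auto
  ultimately show ?thesis
    using data_nonneg by linarith
qed

lemma energy_mono:
  assumes "\<And>n. 0 \<le> q n" "n0 \<nu> \<le> n" "n \<le> m"
  shows "energy q n \<le> energy q m"
  unfolding energy_def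
proof (intro add_mono)
  show "Max ((\<lambda>n. (norm (X n))\<^sup>2) ` {n0 \<nu>..n}) \<le> Max ((\<lambda>n. (norm (X n))\<^sup>2) ` {n0 \<nu>..m})"
    using assms by (intro Max_mono image_mono) auto
  show "sum q {n0 \<nu>..n} \<le> sum q {n0 \<nu>..m}"
    using assms by (intro sum_mono2) auto
  show "am5_dissipation n
     \<le> am5_dissipation m"
    using assms by (auto simp: am5_dissipation_def intro!: sum_mono2 simp del: incr.simps)
qed

lemma sq_le_energy:
  assumes "\<And>n. 0 \<le> q n" "n0 \<nu> \<le> n" "n \<le> m"
  shows "(norm (X n))\<^sup>2 \<le> energy q m"
proof -
  have "(norm (X n))\<^sup>2 \<le> Max ((\<lambda>n. (norm (X n))\<^sup>2) ` {n0 \<nu>..m})"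
    using assms by (intro Max_ge) auto
  moreover have "0 \<le> sum q {n0 \<nu>..m}" "0 \<le> am5_dissipation m"
    using assms by (auto intro!: sum_nonneg am5_dissipation_nonneg)
  ultimately show ?thesis
    unfolding energy_def by linarith
qed

lemma energy_nonneg:
  assumes "\<And>n. 0 \<le> q n" "n0 \<nu> \<le> m"
  shows "0 \<le> energy q m"
  by (rule order_trans[OF zero_le_power2[of "norm (X m)"] sq_le_energy]) (use assms in auto)

text \<open>
  Combines the balance with the summation by parts. The boundary terms cost a factor \<open>\<kappa>\<^sup>2\<close> of the
  energy, and the square root is split by Young's inequality with a weight chosen such that the
  energy reappears with a factor that a later multiplication by 163 keeps below 1.
\<close>
lemma energy_step:
  assumes q: "\<And>n. 0 \<le> q n" and \<Lambda>: "0 \<le> \<Lambda>" and m: "n0 \<nu> \<le> m" "m \<le> N"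
    and bal: "(\<Sum>n=n0 \<nu>..m. inner (incr 1 X n) (M_op \<nu> X n)) + (\<Sum>n=n0 \<nu>..m. q n)
      \<le> \<Lambda> * sqrt (initial + energy q m)"
  shows "(norm (X m))\<^sup>2 / 2 + (\<Sum>n=n0 \<nu>..m. q n)
      + am5_dissipation m / 160
    \<le> 20000000000000 * data + energy q m / 500 + 250 * \<Lambda>\<^sup>2 + 125000 * growth_rate * sumsq 0 m"
proof -
  define E where "E = data + energy q m"
  have en: "0 \<le> energy q m"
    using q m(1) by (rule energy_nonneg)
  have E0: "0 \<le> E"
    using en data_nonneg by (simp add: E_def)
  have XE: "(norm (X i))\<^sup>2 \<le> E" if "i \<le> m" for i
  proof (cases "i < n0 \<nu>")
    case True
    then show ?thesis
      using initial_le_data[of i] en by (simp add: E_def)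
  next
    case False
    then show ?thesis
      using sq_le_energy[of q i m] q that data_nonneg by (simp add: E_def)
  qed
  define A where "A = 50 * \<kappa>\<^sup>2 * E + 4 * data"
  have A: "(norm (incr 1 X i))\<^sup>2 \<le> A" if "1 \<le> i" "i \<le> m" for i
    unfolding A_def using that m XE by (intro first_incr_sq_le) auto
  have "\<kappa>\<^sup>2 * E \<le> 1 / 1000000 * E"
    by (intro mult_right_mono kappa_sq_small E0)
  then have A_le: "A \<le> E / 20000 + 4 * data"
    by (simp add: A_def)
  have c1: "\<bar>am_correction \<nu> X m\<bar> \<le> A"
    using m A by (intro abs_am_correction_le order) auto
  have c2: "\<bar>am_correction \<nu> X (n0 \<nu> - 1)\<bar> \<le> A"
    using m A n0_bounds by (intro abs_am_correction_le order) auto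
  define p where "p = am_potential \<nu> X (n0 \<nu> - 1)"
  have "(norm (X (n0 \<nu> - 1)))\<^sup>2 \<le> data"
    using n0_bounds by (intro initial_le_data) auto
  then have p: "p \<le> data + A"
    using abs_le_D2[OF c2] data_nonneg unfolding p_def am_potential_def by simp
  have "\<Lambda> * sqrt (initial + energy q m) \<le> \<Lambda> * sqrt E"
    using initial_bounds \<Lambda> by (intro mult_left_mono) (auto simp: E_def)
  also have "\<dots> \<le> 250 * \<Lambda>\<^sup>2 + E / 1000"
  proof -
    have "0 \<le> (500 * \<Lambda> - sqrt E)\<^sup>2"
      by simp
    also have "\<dots> = 250000 * \<Lambda>\<^sup>2 - 1000 * (\<Lambda> * sqrt E) + E"
      using E0 by (simp add: power2_diff power_mult_distrib)
    finally show ?thesis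
      by linarith
  qed
  finally have young: "\<Lambda> * sqrt (initial + energy q m) \<le> 250 * \<Lambda>\<^sup>2 + E / 1000" .
  define G where "G = growth_rate * sumsq 0 m"
  have "(norm (X m))\<^sup>2 / 2 + (\<Sum>n=n0 \<nu>..m. q n) + am5_dissipation m / 160
      \<le> am_correction \<nu> X m + p + 10000000000000 * data + 125000 * G + 250 * \<Lambda>\<^sup>2 + E / 1000"
    using order_trans[OF bal young] sum_am_defect_le[OF m]
    unfolding sum_am_telescope[OF order m(1)] p_def[symmetric] am_potential_def[of \<nu> X m]
      mult.assoc G_def[symmetric] by linarith
  also have "\<dots> \<le> 20000000000000 * data + energy q m / 500 + 250 * \<Lambda>\<^sup>2 + 125000 * G"
    using A_le abs_le_D1[OF c1] p en data_nonneg unfolding E_def by argo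
  finally show ?thesis
    by (simp add: G_def mult.assoc)
qed

text \<open>
  The right-hand side of the energy step at any \<open>n \<le> m\<close> is dominated by that at \<open>m\<close>. This bounds the three parts of the energy by \<open>2\<close>, \<open>1\<close> and \<open>160\<close> times this right-hand side.
  After the energy at \<open>m\<close> is absorbed, only earlier energies remain, multiplied by the growth rate.
\<close>
theorem energy_bound:
  assumes q: "\<And>n. 0 \<le> q n" and \<Lambda>: "0 \<le> \<Lambda>" and N: "n0 \<nu> \<le> N"
    and bal: "\<And>m. n0 \<nu> \<le> m \<Longrightarrow> m \<le> N \<Longrightarrow>
      (\<Sum>n=n0 \<nu>..m. inner (incr 1 X n) (M_op \<nu> X n)) + (\<Sum>n=n0 \<nu>..m. q n)
      \<le> \<Lambda> * sqrt (initial + energy q m)"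
  shows "energy q N \<le> 16000000000000000 * (data + \<Lambda>\<^sup>2) * exp (80000000 * growth_rate * real N)"
proof -
  \<comment> \<open>The implicit energy at \<open>m\<close> is absorbed here, also the one inside \<open>sumsq 0 m\<close>, since the growth rate is tiny.\<close>
  have rec: "energy q m \<le> 16000000000000000 * (data + \<Lambda>\<^sup>2)
      + 80000000 * growth_rate * (\<Sum>n=n0 \<nu>..<m. energy q n)"
    if m: "n0 \<nu> \<le> m" "m \<le> N" for m
  proof -
    define B where "B n = 20000000000000 * data + energy q n / 500 + 250 * \<Lambda>\<^sup>2
      + 125000 * growth_rate * sumsq 0 n" for n
    have B: "(norm (X n))\<^sup>2 / 2 + (\<Sum>n=n0 \<nu>..n. q n)
        + am5_dissipation n / 160 \<le> B n"
      if "n0 \<nu> \<le> n" "n \<le> N" for n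
      unfolding B_def using that by (intro energy_step q \<Lambda> bal)
    have B_mono: "B n \<le> B m" if "n0 \<nu> \<le> n" "n \<le> m" for n
    proof -
      have "sumsq 0 n \<le> sumsq 0 m"
        unfolding sumsq_def using that by (intro sum_mono2) auto
      then have "growth_rate * sumsq 0 n \<le> growth_rate * sumsq 0 m"
        by (intro mult_left_mono growth_rate_bounds)
      then show ?thesis
        using energy_mono[of q n m] q that by (simp add: B_def)
    qed
    have pos: "0 \<le> (\<Sum>n=n0 \<nu>..n. q n)" "0 \<le> am5_dissipation n" "0 \<le> (norm (X n))\<^sup>2" for n
      using q by (auto intro!: sum_nonneg am5_dissipation_nonneg)
    have "Max ((\<lambda>n. (norm (X n))\<^sup>2) ` {n0 \<nu>..m}) \<le> 2 * B m"
    proof (subst Max_le_iff)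
      show "\<forall>a\<in>(\<lambda>n. (norm (X n))\<^sup>2) ` {n0 \<nu>..m}. a \<le> 2 * B m"
      proof clarify
        fix n assume n: "n \<in> {n0 \<nu>..m}"
        then have "(norm (X n))\<^sup>2 / 2 \<le> B n"
          using B[of n] pos[of n] m by simp
        then show "(norm (X n))\<^sup>2 \<le> 2 * B m"
          using B_mono[of n] n by simp
      qed
    qed (use m in auto)
    moreover have "(\<Sum>n=n0 \<nu>..m. q n) \<le> B m"
      using B[of m] pos[of m] m by linarith
    moreover have "am5_dissipation m \<le> 160 * B m"
      using B[of m] pos[of m] m by linarith
    ultimately have "energy q m \<le> 163 * B m"
      by (simp add: energy_def del: incr.simps)
    moreover have "sumsq 0 m \<le> data + (\<Sum>n=n0 \<nu>..<m. energy q n) + energy q m"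
    proof -
      have "sumsq 0 m = (\<Sum>n\<in>{..<n0 \<nu>} \<union> {n0 \<nu>..m}. (norm (X n))\<^sup>2)"
        unfolding sumsq_def using m by (intro sum.cong) auto
      also have "\<dots> = initial + (\<Sum>n=n0 \<nu>..m. (norm (X n))\<^sup>2)"
        unfolding initial_def by (intro sum.union_disjoint) auto
      also have "(\<Sum>n=n0 \<nu>..m. (norm (X n))\<^sup>2) \<le> (\<Sum>n=n0 \<nu>..m. energy q n)"
        using q by (intro sum_mono sq_le_energy) auto
      also have "\<dots> = (\<Sum>n=n0 \<nu>..<m. energy q n) + energy q m"
        using m by (simp add: sum.last_plus add.commute)
      finally show ?thesis
        using initial_bounds by linarith
    qed
    then have "growth_rate * sumsq 0 m \<le> growth_rate * (data + (\<Sum>n=n0 \<nu>..<m. energy q n) + energy q m)"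
      by (intro mult_left_mono growth_rate_bounds)
    moreover have "growth_rate * (data + energy q m) \<le> 1 / 1000000000000 * (data + energy q m)"
      using energy_nonneg[of q m] q m(1) data_nonneg
      by (intro mult_right_mono growth_rate_bounds) auto
    moreover have "0 \<le> growth_rate * (\<Sum>n=n0 \<nu>..<m. energy q n)"
    proof (intro mult_nonneg_nonneg growth_rate_bounds sum_nonneg)
      fix n assume "n \<in> {n0 \<nu>..<m}"
      then show "0 \<le> energy q n"
        using q by (intro energy_nonneg) auto
    qed
    ultimately show ?thesis
      using data_nonneg zero_le_power2[of \<Lambda>] unfolding B_def distrib_left mult.assoc
      by linarith
  qed
  have "energy q (n0 \<nu> + (N - n0 \<nu>)) \<le> 16000000000000000 * (data + \<Lambda>\<^sup>2)
      * exp (80000000 * growth_rate * real (N - n0 \<nu>))"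
  proof (rule discrete_gronwall[where u = "\<lambda>i. energy q (n0 \<nu> + i)"])
    fix i assume i: "i \<le> N - n0 \<nu>"
    have "(\<Sum>n=n0 \<nu>..<n0 \<nu> + i. energy q n) = (\<Sum>j<i. energy q (n0 \<nu> + j))"
      by (rule sum.reindex_bij_witness[of _ "\<lambda>j. n0 \<nu> + j" "\<lambda>n. n - n0 \<nu>"]) auto
    then show "energy q (n0 \<nu> + i) \<le> 16000000000000000 * (data + \<Lambda>\<^sup>2)
        + 80000000 * growth_rate * (\<Sum>j<i. energy q (n0 \<nu> + j))"
      using rec[of "n0 \<nu> + i"] i N by simp
  qed (use growth_rate_bounds data_nonneg in auto)
  also have "\<dots> \<le> 16000000000000000 * (data + \<Lambda>\<^sup>2) * exp (80000000 * growth_rate * real N)"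
    using growth_rate_bounds data_nonneg by (intro mult_left_mono) (auto intro: mult_left_mono)
  finally show ?thesis
    using N by simp
qed

end

section \<open>Skew operators and the tested scheme\<close>

lemma M_op_incr:
  "M_op \<nu> (\<lambda>n. Y n - Y (n - 1)) n = M_op \<nu> Y n - M_op \<nu> Y (n - 1)"
  by (simp add: M_op_def scaleR_diff_right sum_subtractf diff_commute)

lemma M_op_mem:
  assumes "subspace S" "\<And>n. Y n \<in> S"
  shows "M_op \<nu> Y n \<in> S"
  unfolding M_op_def using assms by (intro subspace_sum subspace_scale) auto

lemma incr_mem:
  assumes "subspace S" "\<And>n. Y n \<in> S"
  shows "incr k Y n \<in> S"
  using assms by (induction k arbitrary: n) (auto intro: subspace_diff)

lemma D_op_mem:
  assumes "subspace S" "\<And>n. Y n \<in> S"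
  shows "D_op \<tau> Y n \<in> S"
  unfolding D_op_def using assms by (intro subspace_scale subspace_diff) auto

lemma incr_scaleR: "incr k (\<lambda>n. c *\<^sub>R Y n) n = c *\<^sub>R incr k Y n"
  by (induction k arbitrary: n) (auto simp: scaleR_diff_right)

lemma S_op_eq_incr: "S_op \<nu> \<tau> \<delta> V n = M_op \<nu> V n + (\<delta> / \<tau>) *\<^sub>R incr 1 V n"
  by (simp add: S_op_def D_op_def)

text \<open>
  Every quantity up to index \<open>m\<close> depends only on the values up to \<open>m\<close>. This allows a solution to be
  extended by zero, so that all its values lie in the discrete space.
\<close>
lemma sequence_cong:
  assumes "\<And>i. i \<le> m \<Longrightarrow> V i = V' i"
  shows "n \<le> m \<Longrightarrow> M_op \<nu> V n = M_op \<nu> V' n"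
    and "n \<le> m \<Longrightarrow> incr k V n = incr k V' n"
    and "n \<le> m \<Longrightarrow> A_op \<nu> G \<tau> V n = A_op \<nu> G \<tau> V' n"
    and "n \<le> m \<Longrightarrow> P_op \<nu> G \<tau> \<delta> V n = P_op \<nu> G \<tau> \<delta> V' n"
    and "n0 \<nu> \<le> m \<Longrightarrow> initial_sq \<nu> G \<delta> V = initial_sq \<nu> G \<delta> V'"
    and "energy_norm_sq \<nu> G \<tau> \<delta> m V = energy_norm_sq \<nu> G \<tau> \<delta> m V'"
proof -
  show M: "M_op \<nu> V n = M_op \<nu> V' n" if "n \<le> m" for n
    unfolding M_op_def using assms that by (intro sum.cong) auto
  show I: "incr k V n = incr k V' n" if "n \<le> m" for n k
    using that by (induction k arbitrary: n) (auto simp: assms)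
  show A: "A_op \<nu> G \<tau> V n = A_op \<nu> G \<tau> V' n" if "n \<le> m" for n
    using M[OF that] that assms by (simp add: A_op_def D_op_def)
  show "P_op \<nu> G \<tau> \<delta> V n = P_op \<nu> G \<tau> \<delta> V' n" if "n \<le> m"
    using M[OF that] I[OF that, of 1] by (simp only: P_op_def S_op_eq_incr)
  show "initial_sq \<nu> G \<delta> V = initial_sq \<nu> G \<delta> V'" if "n0 \<nu> \<le> m"
    unfolding initial_sq_def using that assms by (intro sum.cong) auto
  show "energy_norm_sq \<nu> G \<tau> \<delta> m V = energy_norm_sq \<nu> G \<tau> \<delta> m V'"
    unfolding energy_norm_sq_def using assms A I
    by (intro arg_cong2[of _ _ _ _ "(+)"] arg_cong2[of _ _ _ _ "(*)"] arg_cong[of _ _ Max]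
        image_cong sum.cong if_cong refl) auto
qed

locale skew =
  fixes \<V> :: "'a::{real_inner,complete_space} set" and G :: "'a \<Rightarrow> 'a"
  assumes skew: "skew_operator \<V> G"
begin

lemma subspace_V: "subspace \<V>"
  and G_add: "U \<in> \<V> \<Longrightarrow> W \<in> \<V> \<Longrightarrow> G (U + W) = G U + G W"
  and G_scale: "U \<in> \<V> \<Longrightarrow> G (c *\<^sub>R U) = c *\<^sub>R G U"
  and G_skew: "U \<in> \<V> \<Longrightarrow> W \<in> \<V> \<Longrightarrow> inner (G U) W = - inner U (G W)"
  using skew by (auto simp: skew_operator_def)

lemma G_diff: "U \<in> \<V> \<Longrightarrow> W \<in> \<V> \<Longrightarrow> G (U - W) = G U - G W"
  using G_add[of U "(-1) *\<^sub>R W"] G_scale[of W "-1"] subspace_scale[OF subspace_V, of W "-1"] by simp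

lemma inner_G_self: "U \<in> \<V> \<Longrightarrow> inner (G U) U = 0"
  using G_skew[of U U] by (simp add: inner_commute)

lemma T_add: "U \<in> \<V> \<Longrightarrow> W \<in> \<V> \<Longrightarrow> T_op G \<delta> (U + W) = T_op G \<delta> U + T_op G \<delta> W"
  and T_diff: "U \<in> \<V> \<Longrightarrow> W \<in> \<V> \<Longrightarrow> T_op G \<delta> (U - W) = T_op G \<delta> U - T_op G \<delta> W"
  and T_scale: "U \<in> \<V> \<Longrightarrow> T_op G \<delta> (c *\<^sub>R U) = c *\<^sub>R T_op G \<delta> U"
  by (simp_all add: T_op_def G_add G_diff G_scale algebra_simps)

lemma T_zero: "T_op G \<delta> 0 = 0"
  using T_scale[of 0 \<delta> 0] subspace_0[OF subspace_V] by simp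

lemma T_sum:
  assumes "\<And>i. i \<in> I \<Longrightarrow> f i \<in> \<V>"
  shows "T_op G \<delta> (sum f I) = (\<Sum>i\<in>I. T_op G \<delta> (f i))"
  using assms
proof (induction I rule: infinite_finite_induct)
  case (insert i I)
  then have "sum f I \<in> \<V>"
    by (intro subspace_sum[OF subspace_V]) auto
  then show ?case
    using insert by (simp add: T_add)
qed (simp_all add: T_zero)

text \<open>
  By skewness \<open>T\<^sub>\<delta>\<close> is an isometry for the graph inner product. The graph norm of \<open>V\<close> can therefore be
  treated as the ordinary norm of \<open>T\<^sub>\<delta> V\<close>.
\<close>
lemma inner_T_T:
  assumes "U \<in> \<V>" "W \<in> \<V>"
  shows "inner (T_op G \<delta> U) (T_op G \<delta> W) = inner U W + \<delta>\<^sup>2 * inner (G U) (G W)"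
  using G_skew[OF assms] by (simp add: T_op_def inner_add_left inner_add_right power2_eq_square algebra_simps)

lemma norm_T_sq: "U \<in> \<V> \<Longrightarrow> (norm (T_op G \<delta> U))\<^sup>2 = graph_norm_sq G \<delta> U"
  by (simp add: power2_norm_eq_inner inner_T_T graph_norm_sq_def)

lemma norm_le_norm_T: "U \<in> \<V> \<Longrightarrow> norm U \<le> norm (T_op G \<delta> U)"
  by (rule power2_le_imp_le) (simp_all add: norm_T_sq graph_norm_sq_def)

lemma T_incr:
  assumes "\<And>n. Y n \<in> \<V>"
  shows "T_op G \<delta> (incr k Y n) = incr k (\<lambda>n. T_op G \<delta> (Y n)) n"
  by (induction k arbitrary: n) (simp_all add: T_diff incr_mem[OF subspace_V assms])

lemma T_M_op:
  assumes "\<And>n. Y n \<in> \<V>"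
  shows "T_op G \<delta> (M_op \<nu> Y n) = M_op \<nu> (\<lambda>n. T_op G \<delta> (Y n)) n"
  unfolding M_op_def
  by (subst T_sum) (auto simp: T_scale assms intro!: subspace_scale[OF subspace_V])

lemma A_op_incr:
  assumes "\<And>n. Y n \<in> \<V>"
  shows "A_op \<nu> G \<tau> (incr (Suc k) Y) n = A_op \<nu> G \<tau> (incr k Y) n - A_op \<nu> G \<tau> (incr k Y) (n - 1)"
proof -
  have "incr (Suc k) Y = (\<lambda>n. incr k Y n - incr k Y (n - 1))"
    by auto
  then show ?thesis
    using assms by (simp add: A_op_def D_op_def M_op_incr[unfolded One_nat_def] G_diff
        M_op_mem[OF subspace_V] incr_mem[OF subspace_V] scaleR_diff_right del: incr.simps)
qed

text \<open>
  The energy identity. Writing \<open>d = D V\<^sup>n\<close> and \<open>u = M V\<^sup>n\<close>, the vector \<open>P\<^sub>\<delta> V\<^sup>n\<close> equals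
  \<open>u + \<delta> (d + G u) + \<delta>\<^sup>2 G d\<close>, and skewness removes \<open>(G u, u)\<close> and \<open>(d, G d)\<close>.
\<close>
lemma inner_A_P:
  assumes "\<And>n. Y n \<in> \<V>"
  shows "inner (A_op \<nu> G \<tau> Y n) (P_op \<nu> G \<tau> \<delta> Y n)
    = inner (T_op G \<delta> (D_op \<tau> Y n)) (T_op G \<delta> (M_op \<nu> Y n)) + \<delta> * (norm (A_op \<nu> G \<tau> Y n))\<^sup>2"
proof -
  define d where "d = D_op \<tau> Y n"
  define u where "u = M_op \<nu> Y n"
  have mem: "d \<in> \<V>" "u \<in> \<V>"
    using assms by (auto simp: d_def u_def intro!: D_op_mem M_op_mem subspace_V)
  have "P_op \<nu> G \<tau> \<delta> Y n = u + \<delta> *\<^sub>R d + \<delta> *\<^sub>R (G u + \<delta> *\<^sub>R G d)"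
    using mem subspace_scale[OF subspace_V]
    by (simp add: P_op_def S_op_def T_op_def d_def u_def G_add G_scale)
  moreover have "A_op \<nu> G \<tau> Y n = d + G u"
    by (simp add: A_op_def d_def u_def)
  moreover have "inner d (G d) = 0" "inner (G u) u = 0" "inner u (G u) = 0"
    using inner_G_self mem by (simp_all add: inner_commute)
  ultimately show ?thesis
    unfolding d_def[symmetric] u_def[symmetric] inner_T_T[OF mem] power2_norm_eq_inner
    by (simp add: inner_add_left inner_add_right inner_commute
        power2_eq_square algebra_simps)
qed

lemma differenced_scheme:
  assumes "solves_scheme \<nu> G Vh \<tau> \<delta> N V R" "\<And>n. V n \<in> Vh" "Vh \<subseteq> \<V>" "W \<in> Vh"
    and "n0 \<nu> + k \<le> n" "n \<le> N"
  shows "inner (A_op \<nu> G \<tau> (incr k V) n) (T_op G \<delta> W) = inner (incr k R n) (T_op G \<delta> W)"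
  using assms(5,6)
proof (induction k arbitrary: n)
  case 0
  have "incr 0 V = V"
    by auto
  then show ?case
    using assms(1,4) 0 by (auto simp: solves_scheme_def)
next
  case (Suc k)
  have "A_op \<nu> G \<tau> (incr (Suc k) V) n = A_op \<nu> G \<tau> (incr k V) n - A_op \<nu> G \<tau> (incr k V) (n - 1)"
    using assms by (intro A_op_incr) auto
  moreover have "incr (Suc k) R n = incr k R n - incr k R (n - 1)"
    by simp
  moreover have "n0 \<nu> + k \<le> n - 1" "n - 1 \<le> N"
    using Suc.prems by auto
  ultimately show ?case
    using Suc.IH[of n] Suc.IH[of "n - 1"] Suc.prems by (simp only: inner_diff_left)
qed

text \<open>
  The scheme does not identify \<open>A\<^sub>\<tau> V\<^sup>n\<close> itself, because \<open>G\<close> need not map the discrete space to itself. Testing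
  the \<open>k\<close>-th difference with \<open>Z = d\<^sup>k\<^sup>+\<^sup>1 V\<^sup>n\<close> nevertheless controls \<open>Z\<close>: the term \<open>(Z, T\<^sub>\<delta> Z)\<close> is \<open>\<parallel>Z\<parallel>\<^sup>2\<close> by
  skewness, and the inverse inequality with \<open>\<delta> \<mu> \<le> c\<close> makes the norms of \<open>Z\<close> and \<open>T\<^sub>\<delta> Z\<close> equivalent.
\<close>
lemma incr_decay:
  assumes sol: "solves_scheme \<nu> G Vh \<tau> \<delta> N V R" and V: "\<And>n. V n \<in> Vh"
    and Vh: "subspace Vh" "Vh \<subseteq> \<V>" and "0 < \<tau>" "0 \<le> \<delta>" "0 \<le> \<mu>"
    and inv: "\<And>W. W \<in> Vh \<Longrightarrow> norm (G W) \<le> \<mu> * norm W" and c: "\<delta> * \<mu> \<le> c"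
    and n: "n0 \<nu> + k \<le> n" "n \<le> N"
  defines "X \<equiv> \<lambda>n. T_op G \<delta> (V n)" and "b \<equiv> 1 + c\<^sup>2"
  shows "norm (incr (Suc k) X n) \<le> b * \<tau> * (\<mu> * norm (M_op \<nu> (incr k X) n) + norm (incr k R n))"
proof -
  have V\<V>: "\<And>n. V n \<in> \<V>"
    using V Vh by auto
  define Z where "Z = incr (Suc k) V n"
  define u where "u = M_op \<nu> (incr k V) n"
  have Z: "Z \<in> Vh" and u: "u \<in> Vh"
    unfolding Z_def u_def by (auto intro!: M_op_mem incr_mem Vh V simp del: incr.simps)
  then have \<V>: "Z \<in> \<V>" "u \<in> \<V>"
    using Vh by auto
  have TZ: "T_op G \<delta> Z = incr (Suc k) X n"
    unfolding Z_def X_def using V\<V> by (rule T_incr)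
  have kX: "incr k X = (\<lambda>n. T_op G \<delta> (incr k V n))"
    unfolding X_def using T_incr[OF V\<V>] by auto
  have Tu: "T_op G \<delta> u = M_op \<nu> (incr k X) n"
    unfolding u_def kX using V\<V> by (intro T_M_op incr_mem subspace_V)
  have "norm (G u) \<le> \<mu> * norm u"
    by (rule inv[OF u])
  also have "\<dots> \<le> \<mu> * norm (T_op G \<delta> u)"
    by (intro mult_left_mono norm_le_norm_T \<V> \<open>0 \<le> \<mu>\<close>)
  finally have Gu: "norm (G u) \<le> \<mu> * norm (M_op \<nu> (incr k X) n)"
    by (simp add: Tu)
  have "\<delta> * norm (G Z) \<le> c * norm Z"
  proof -
    have "\<delta> * norm (G Z) \<le> \<delta> * (\<mu> * norm Z)"
      by (intro mult_left_mono inv Z \<open>0 \<le> \<delta>\<close>)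
    also have "\<dots> \<le> c * norm Z"
      using c mult_right_mono[of "\<delta> * \<mu>" c "norm Z"] by (simp add: mult.assoc)
    finally show ?thesis .
  qed
  then have "(\<delta> * norm (G Z))\<^sup>2 \<le> (c * norm Z)\<^sup>2"
    using \<open>0 \<le> \<delta>\<close> by (intro power_mono) auto
  then have up: "(norm (T_op G \<delta> Z))\<^sup>2 \<le> b * (norm Z)\<^sup>2"
    by (simp add: norm_T_sq[OF \<V>(1)] graph_norm_sq_def b_def power_mult_distrib algebra_simps)
  have "A_op \<nu> G \<tau> (incr k V) n = (1 / \<tau>) *\<^sub>R Z + G u"
    by (simp add: A_op_def D_op_def Z_def u_def)
  moreover have "inner Z (T_op G \<delta> Z) = (norm Z)\<^sup>2"
    using inner_G_self[OF \<V>(1)]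
    by (simp add: T_op_def inner_add_right power2_norm_eq_inner inner_commute)
  ultimately have "(norm Z)\<^sup>2 / \<tau> + inner (G u) (T_op G \<delta> Z) = inner (incr k R n) (T_op G \<delta> Z)"
    using differenced_scheme[OF sol V Vh(2) Z n] by (simp add: inner_add_left)
  then have "(norm Z)\<^sup>2 / \<tau> = inner (incr k R n - G u) (T_op G \<delta> Z)"
    by (simp add: inner_diff_left)
  also have "\<dots> \<le> norm (incr k R n - G u) * norm (T_op G \<delta> Z)"
    by (rule norm_cauchy_schwarz)
  also have "\<dots> \<le> (\<mu> * norm (M_op \<nu> (incr k X) n) + norm (incr k R n)) * norm (T_op G \<delta> Z)"
    using norm_triangle_ineq4[of "incr k R n" "G u"] Gu by (intro mult_right_mono) auto
  finally have "(norm Z)\<^sup>2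
      \<le> \<tau> * ((\<mu> * norm (M_op \<nu> (incr k X) n) + norm (incr k R n)) * norm (T_op G \<delta> Z))"
    using \<open>0 < \<tau>\<close> by (simp add: field_simps)
  then have "b * (norm Z)\<^sup>2
      \<le> b * (\<tau> * ((\<mu> * norm (M_op \<nu> (incr k X) n) + norm (incr k R n)) * norm (T_op G \<delta> Z)))"
    by (intro mult_left_mono) (auto simp: b_def)
  with up have "norm (T_op G \<delta> Z) * norm (T_op G \<delta> Z)
      \<le> (b * \<tau> * (\<mu> * norm (M_op \<nu> (incr k X) n) + norm (incr k R n))) * norm (T_op G \<delta> Z)"
    by (simp add: power2_eq_square mult_ac)
  moreover have "0 \<le> b * \<tau> * (\<mu> * norm (M_op \<nu> (incr k X) n) + norm (incr k R n))"
    using \<open>0 < \<tau>\<close> \<open>0 \<le> \<mu>\<close> by (simp add: b_def)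
  ultimately show ?thesis
    unfolding TZ[symmetric] by (cases "norm (T_op G \<delta> Z) = 0") auto
qed

lemma energy_norm_parts_nonneg:
  assumes "0 \<le> \<tau>" "0 \<le> \<delta>"
  shows "0 \<le> initial_sq \<nu> G \<delta> V" "0 \<le> \<tau> * \<delta> * (\<Sum>n=n0 \<nu>..m. (norm (A_op \<nu> G \<tau> V n))\<^sup>2)"
    "0 \<le> (if \<nu> = 5 then (\<Sum>n=4..<m. graph_norm_sq G \<delta> (incr 3 V n)) else 0)"
  using assms by (auto simp: initial_sq_def graph_norm_sq_def intro!: sum_nonneg mult_nonneg_nonneg)

lemma norm_T_le_energy_norm:
  assumes "0 \<le> \<tau>" "0 \<le> \<delta>" "n0 \<nu> \<le> m" "i \<le> m"
  shows "(norm (T_op G \<delta> (V i)))\<^sup>2 \<le> initial_sq \<nu> G \<delta> V + energy_norm_sq \<nu> G \<tau> \<delta> m V"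
proof -
  let ?Mx = "Max ((\<lambda>n. (norm (T_op G \<delta> (V n)))\<^sup>2) ` {n0 \<nu>..m})"
  have Mx: "(norm (T_op G \<delta> (V n)))\<^sup>2 \<le> ?Mx" if "n0 \<nu> \<le> n" "n \<le> m" for n
    using that by (intro Max_ge) auto
  have "(norm (T_op G \<delta> (V i)))\<^sup>2 \<le> initial_sq \<nu> G \<delta> V + ?Mx"
  proof (cases "i < n0 \<nu>")
    case True
    then have "(norm (T_op G \<delta> (V i)))\<^sup>2 \<le> initial_sq \<nu> G \<delta> V"
      unfolding initial_sq_def by (intro member_le_sum) auto
    moreover have "0 \<le> ?Mx"
      using order_trans[OF zero_le_power2 Mx[of m]] assms by simp
    ultimately show ?thesis
      by linarith
  next
    case False
    then show ?thesis
      using Mx[of i] False assms(4) energy_norm_parts_nonneg(1)[OF assms(1,2), of \<nu> V] by linarith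
  qed
  then show ?thesis
    using energy_norm_parts_nonneg(2,3)[OF assms(1,2), where \<nu> = \<nu> and V = V and m = m] unfolding energy_norm_sq_def
    by linarith
qed

text \<open>
  Guarantees that the supremum in the dual norm is over a bounded set, and that the numerator
  vanishes together with the denominator. The constant depends on the residual and is not meant to
  be sharp.
\<close>
lemma residual_functional_bounded:
  assumes "\<nu> \<in> {3, 4, 5}" "0 < \<tau>" "0 \<le> \<delta>" "n0 \<nu> \<le> m" "\<And>n. V n \<in> \<V>"
  shows "\<tau> * (\<Sum>n=n0 \<nu>..m. inner (R n) (P_op \<nu> G \<tau> \<delta> V n))
    \<le> (\<tau> * (\<Sum>n=n0 \<nu>..m. norm (R n)) * (real \<nu> + 2 * \<delta> / \<tau>))
      * sqrt (initial_sq \<nu> G \<delta> V + energy_norm_sq \<nu> G \<tau> \<delta> m V)"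
proof -
  define s where "s = sqrt (initial_sq \<nu> G \<delta> V + energy_norm_sq \<nu> G \<tau> \<delta> m V)"
  define X where "X = (\<lambda>n. T_op G \<delta> (V n))"
  have X: "norm (X i) \<le> s" if "i \<le> m" for i
    unfolding X_def s_def
    using norm_T_le_energy_norm[of \<tau> \<delta> \<nu> m i V] assms that by (intro real_le_rsqrt) auto
  have P: "norm (P_op \<nu> G \<tau> \<delta> V n) \<le> (real \<nu> + 2 * \<delta> / \<tau>) * s" if "n \<le> m" for n
  proof -
    have "P_op \<nu> G \<tau> \<delta> V n = M_op \<nu> X n + (\<delta> / \<tau>) *\<^sub>R incr 1 X n"
      unfolding P_op_def S_op_eq_incr X_def
      using assms(5) subspace_V
      by (simp add: T_add T_scale T_M_op T_diff M_op_mem subspace_diff subspace_scale)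
    moreover have "norm (M_op \<nu> X n) \<le> real \<nu> * s"
      using norm_M_op_le[OF assms(1), of X n] sum_bounded_above[of "{..<\<nu>}" "\<lambda>j. norm (X (n - j))" s]
        X that by force
    moreover have "norm ((\<delta> / \<tau>) *\<^sub>R incr 1 X n) \<le> \<delta> / \<tau> * (2 * s)"
      using norm_incr_le[of n X s 1] X that assms
      by (auto simp del: incr.simps intro!: mult_left_mono divide_right_mono)
    ultimately have "norm (P_op \<nu> G \<tau> \<delta> V n) \<le> real \<nu> * s + \<delta> / \<tau> * (2 * s)"
      using norm_triangle_ineq[of "M_op \<nu> X n" "(\<delta> / \<tau>) *\<^sub>R incr 1 X n"] by simp
    then show ?thesis
      by (simp add: algebra_simps)
  qed
  have "(\<Sum>n=n0 \<nu>..m. inner (R n) (P_op \<nu> G \<tau> \<delta> V n))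
      \<le> (\<Sum>n=n0 \<nu>..m. norm (R n) * ((real \<nu> + 2 * \<delta> / \<tau>) * s))"
    by (intro sum_mono order_trans[OF norm_cauchy_schwarz] mult_left_mono P) auto
  then have "\<tau> * (\<Sum>n=n0 \<nu>..m. inner (R n) (P_op \<nu> G \<tau> \<delta> V n))
      \<le> \<tau> * ((\<Sum>n=n0 \<nu>..m. norm (R n)) * ((real \<nu> + 2 * \<delta> / \<tau>) * s))"
    using assms by (simp add: sum_distrib_right)
  then show ?thesis
    by (simp add: s_def mult.assoc)
qed

text \<open>
  The truncation of \<open>V\<close> at \<open>m\<close> is an admissible competitor in the supremum with index \<open>m\<close>.
\<close>
lemma dual_norm_bound:
  assumes "\<nu> \<in> {3, 4, 5}" "0 < \<tau>" "0 \<le> \<delta>" "n0 \<nu> \<le> m" "m \<le> N"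
    and Vh: "subspace Vh" "Vh \<subseteq> \<V>" "\<And>n. V n \<in> Vh"
  shows "0 \<le> dual_norm \<nu> G Vh \<tau> \<delta> N R"
    and "\<tau> * (\<Sum>n=n0 \<nu>..m. inner (R n) (P_op \<nu> G \<tau> \<delta> V n))
      \<le> dual_norm \<nu> G Vh \<tau> \<delta> N R * sqrt (initial_sq \<nu> G \<delta> V + energy_norm_sq \<nu> G \<tau> \<delta> m V)"
proof -
  define den where "den V = initial_sq \<nu> G \<delta> V + energy_norm_sq \<nu> G \<tau> \<delta> m V" for V
  define num where "num V = \<tau> * (\<Sum>n=n0 \<nu>..m. inner (R n) (P_op \<nu> G \<tau> \<delta> V n))" for V
  define K where "K = \<tau> * (\<Sum>n=n0 \<nu>..m. norm (R n)) * (real \<nu> + 2 * \<delta> / \<tau>)"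
  define Q where "Q = insert 0 {num V / sqrt (den V) | V. (\<forall>n. V n \<in> Vh) \<and> (\<forall>n>m. V n = 0) \<and> den V > 0}"
  have num_le: "num V \<le> K * sqrt (den V)" if "\<And>n. V n \<in> Vh" for V
    unfolding num_def K_def den_def
    using that Vh(2) assms(1-4) by (intro residual_functional_bounded) auto
  have "0 \<le> K"
    using assms by (simp add: K_def sum_nonneg)
  have "x \<le> K" if "x \<in> Q" for x
    using that num_le \<open>0 \<le> K\<close> unfolding Q_def by (auto simp: divide_le_eq)
  then have bdd: "bdd_above Q"
    by (auto simp: bdd_above_def)
  have Sup_le: "Sup Q \<le> dual_norm \<nu> G Vh \<tau> \<delta> N R"
    unfolding dual_norm_def Q_def num_def den_def using assms by (intro Max_ge) auto
  have "0 \<le> Sup Q"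
    using bdd by (intro cSup_upper) (auto simp: Q_def)
  then show dual: "0 \<le> dual_norm \<nu> G Vh \<tau> \<delta> N R"
    using Sup_le by linarith
  define V' where "V' = (\<lambda>n. if n \<le> m then V n else 0)"
  have V': "\<And>n. V' n \<in> Vh" "\<forall>n>m. V' n = 0" "\<And>i. i \<le> m \<Longrightarrow> V i = V' i"
    using Vh subspace_0[OF Vh(1)] by (auto simp: V'_def)
  have "num V = num V'"
    unfolding num_def using V'(3) by (simp add: sequence_cong(4)[of m V V'])
  moreover have "den V = den V'"
    unfolding den_def using V'(3) assms by (simp add: sequence_cong(5,6)[of m V V'])
  moreover have "num V' \<le> dual_norm \<nu> G Vh \<tau> \<delta> N R * sqrt (den V')"
  \<comment> \<open>The supremum ranges over positive denominators only.\<close>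
  proof (cases "den V' > 0")
    case True
    then have "num V' / sqrt (den V') \<le> Sup Q"
      using V' bdd by (intro cSup_upper) (auto simp: Q_def)
    then have "num V' / sqrt (den V') \<le> dual_norm \<nu> G Vh \<tau> \<delta> N R"
      using Sup_le by linarith
    then show ?thesis
      using True by (simp add: divide_le_eq)
  next
    case False
    have "0 \<le> den V'"
      unfolding den_def using norm_T_le_energy_norm[of \<tau> \<delta> \<nu> m m V'] assms
      by (auto intro: order_trans[OF zero_le_power2])
    then have "den V' = 0"
      using False by simp
    then show ?thesis
      using num_le[of V'] V'(1) by simp
  qed
  ultimately show "\<tau> * (\<Sum>n=n0 \<nu>..m. inner (R n) (P_op \<nu> G \<tau> \<delta> V n))
      \<le> dual_norm \<nu> G Vh \<tau> \<delta> N R * sqrt (initial_sq \<nu> G \<delta> V + energy_norm_sq \<nu> G \<tau> \<delta> m V)"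
    unfolding num_def den_def by (simp only:)
qed

end

section \<open>Stability of the scheme\<close>

context skew
begin

lemma stability_of_extended_solution:
  assumes nu: "\<nu> \<in> {3, 4, 5}" and "0 < \<tau>" "0 < \<delta>" "0 \<le> \<mu>"
    and Vh: "subspace Vh" "Vh \<subseteq> \<V>" and inv: "\<And>W. W \<in> Vh \<Longrightarrow> norm (G W) \<le> \<mu> * norm W"
    and c: "\<delta> * \<mu> \<le> c" and small: "(1 + c\<^sup>2) * \<mu> * \<tau> \<le> 1 / 1000"
    and N: "n0 \<nu> \<le> N" and sol: "solves_scheme \<nu> G Vh \<tau> \<delta> N V R" and V: "\<And>n. V n \<in> Vh"
  defines "\<kappa> \<equiv> (1 + c\<^sup>2) * \<mu> * \<tau>"
  shows "energy_norm_sq \<nu> G \<tau> \<delta> N V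
    \<le> 16000000000000000 * (1 + c\<^sup>2)\<^sup>2
        * exp (80000000 * (if \<nu> = 3 then \<kappa> ^ 4 else if \<nu> = 4 then \<kappa> ^ 6 else 0) * real N)
        * (initial_sq \<nu> G \<delta> V + (dual_norm \<nu> G Vh \<tau> \<delta> N R)\<^sup>2 + \<tau> * l2_norm_sq \<tau> (n0 \<nu>) N R)"
proof -
  define b where "b = 1 + c\<^sup>2"
  define X where "X = (\<lambda>n. T_op G \<delta> (V n))"
  define r where "r = (\<lambda>n. (b * \<tau>) *\<^sub>R R n)"
  define q where "q = (\<lambda>n. \<tau> * \<delta> * (norm (A_op \<nu> G \<tau> V n))\<^sup>2)"
  define L where "L = dual_norm \<nu> G Vh \<tau> \<delta> N R"
  have V\<V>: "\<And>n. V n \<in> \<V>"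
    using V Vh by auto
  have b1: "1 \<le> b" "0 \<le> b"
    by (simp_all add: b_def)
  interpret AM_recursion \<nu> X r \<kappa> N
  proof
    fix k n assume n: "n0 \<nu> + k \<le> n" "n \<le> N"
    have "norm (incr (Suc k) X n) \<le> b * \<tau> * (\<mu> * norm (M_op \<nu> (incr k X) n) + norm (incr k R n))"
      unfolding X_def b_def using assms n by (intro incr_decay[OF sol V Vh]) auto
    also have "\<dots> = \<kappa> * norm (M_op \<nu> (incr k X) n) + norm (incr k r n)"
      using b1 \<open>0 < \<tau>\<close> by (simp add: r_def incr_scaleR \<kappa>_def b_def[symmetric] distrib_left mult_ac)
    finally show "norm (incr (Suc k) X n) \<le> \<kappa> * norm (M_op \<nu> (incr k X) n) + norm (incr k r n)" .
  qed (use assms in \<open>auto simp: \<kappa>_def\<close>)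
  have init: "initial = initial_sq \<nu> G \<delta> V"
    unfolding initial_def initial_sq_def by (simp add: X_def)
  have en: "energy q m = energy_norm_sq \<nu> G \<tau> \<delta> m V" for m
  proof -
    have "graph_norm_sq G \<delta> (incr 3 V n) = (norm (incr 3 X n))\<^sup>2" for n
      unfolding X_def T_incr[OF V\<V>, symmetric]
      by (rule norm_T_sq[symmetric]) (intro incr_mem subspace_V V\<V>)
    then show ?thesis
      unfolding energy_def energy_norm_sq_def am5_dissipation_def q_def sum_distrib_left[symmetric]
      by (simp add: X_def del: incr.simps)
  qed
  have L0: "0 \<le> L"
    unfolding L_def using assms by (intro dual_norm_bound(1)[where m = N and V = V]) auto
  have "(\<Sum>n=n0 \<nu>..m. inner (incr 1 X n) (M_op \<nu> X n)) + (\<Sum>n=n0 \<nu>..m. q n)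
      \<le> L * sqrt (initial + energy q m)" if m: "n0 \<nu> \<le> m" "m \<le> N" for m
  proof -
    have "inner (incr 1 X n) (M_op \<nu> X n) + q n = \<tau> * inner (R n) (P_op \<nu> G \<tau> \<delta> V n)"
      if n: "n \<in> {n0 \<nu>..m}" for n
    proof -
      have "S_op \<nu> \<tau> \<delta> V n \<in> Vh"
        unfolding S_op_def by (intro subspace_add subspace_scale M_op_mem D_op_mem Vh V)
      then have "inner (R n) (P_op \<nu> G \<tau> \<delta> V n) = inner (A_op \<nu> G \<tau> V n) (P_op \<nu> G \<tau> \<delta> V n)"
        using sol n m unfolding solves_scheme_def P_op_def by auto
      also have "\<dots> = inner (T_op G \<delta> (D_op \<tau> V n)) (T_op G \<delta> (M_op \<nu> V n))
          + \<delta> * (norm (A_op \<nu> G \<tau> V n))\<^sup>2"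
        using V\<V> by (rule inner_A_P)
      also have "T_op G \<delta> (M_op \<nu> V n) = M_op \<nu> X n"
        unfolding X_def using V\<V> by (rule T_M_op)
      finally have "\<tau> * inner (R n) (P_op \<nu> G \<tau> \<delta> V n)
          = inner (\<tau> *\<^sub>R T_op G \<delta> (D_op \<tau> V n)) (M_op \<nu> X n) + q n"
        by (simp add: q_def distrib_left)
      moreover have "\<tau> *\<^sub>R T_op G \<delta> (D_op \<tau> V n) = incr 1 X n"
        using \<open>0 < \<tau>\<close> V\<V> subspace_V by (simp add: X_def D_op_def T_scale T_diff subspace_diff)
      ultimately show ?thesis
        by simp
    qed
    then have "(\<Sum>n=n0 \<nu>..m. inner (incr 1 X n) (M_op \<nu> X n)) + (\<Sum>n=n0 \<nu>..m. q n)
        = \<tau> * (\<Sum>n=n0 \<nu>..m. inner (R n) (P_op \<nu> G \<tau> \<delta> V n))"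
      unfolding sum.distrib[symmetric] sum_distrib_left by (intro sum.cong) auto
    also have "\<dots> \<le> L * sqrt (initial + energy q m)"
      unfolding init en L_def using assms m by (intro dual_norm_bound(2)) auto
    finally show ?thesis .
  qed
  then have "energy q N \<le> 16000000000000000 * (data + L\<^sup>2) * exp (80000000 * growth_rate * real N)"
    using assms L0 by (intro energy_bound) (auto simp: q_def)
  also have "\<dots> \<le> 16000000000000000 * (b\<^sup>2 * (initial_sq \<nu> G \<delta> V + L\<^sup>2 + \<tau> * l2_norm_sq \<tau> (n0 \<nu>) N R))
      * exp (80000000 * growth_rate * real N)"
  proof (intro mult_right_mono mult_left_mono)
    have "data = initial_sq \<nu> G \<delta> V + b\<^sup>2 * (\<tau> * l2_norm_sq \<tau> (n0 \<nu>) N R)"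
      unfolding data_def initial_sq_def l2_norm_sq_def
      by (simp add: X_def r_def power_mult_distrib sum_distrib_left power2_eq_square mult_ac)
    moreover have "1 * (initial_sq \<nu> G \<delta> V + L\<^sup>2) \<le> b\<^sup>2 * (initial_sq \<nu> G \<delta> V + L\<^sup>2)"
      using b1 initial_bounds init by (intro mult_right_mono) auto
    ultimately show "data + L\<^sup>2 \<le> b\<^sup>2 * (initial_sq \<nu> G \<delta> V + L\<^sup>2 + \<tau> * l2_norm_sq \<tau> (n0 \<nu>) N R)"
      by (simp add: algebra_simps)
  qed auto
  finally show ?thesis
    unfolding en growth_rate_def b_def L_def by (simp only: mult_ac)
qed

lemma stability_of_solution:
  assumes nu: "\<nu> \<in> {3, 4, 5}" and "0 < \<tau>" "0 < \<delta>" "0 \<le> \<mu>"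
    and Vh: "subspace Vh" "Vh \<subseteq> \<V>" and inv: "\<And>W. W \<in> Vh \<Longrightarrow> norm (G W) \<le> \<mu> * norm W"
    and c: "\<delta> * \<mu> \<le> c" and small: "(1 + c\<^sup>2) * \<mu> * \<tau> \<le> 1 / 1000"
    and N: "n0 \<nu> \<le> N" and sol: "solves_scheme \<nu> G Vh \<tau> \<delta> N V R"
  defines "\<kappa> \<equiv> (1 + c\<^sup>2) * \<mu> * \<tau>"
  shows "energy_norm_sq \<nu> G \<tau> \<delta> N V
    \<le> 16000000000000000 * (1 + c\<^sup>2)\<^sup>2
        * exp (80000000 * (if \<nu> = 3 then \<kappa> ^ 4 else if \<nu> = 4 then \<kappa> ^ 6 else 0) * real N)
        * (initial_sq \<nu> G \<delta> V + (dual_norm \<nu> G Vh \<tau> \<delta> N R)\<^sup>2 + \<tau> * l2_norm_sq \<tau> (n0 \<nu>) N R)"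
proof -
  define V' where "V' = (\<lambda>n. if n \<le> N then V n else 0)"
  have eq: "V i = V' i" if "i \<le> N" for i
    using that by (simp add: V'_def)
  have V': "\<And>n. V' n \<in> Vh"
    using sol subspace_0[OF Vh(1)] by (simp add: V'_def solves_scheme_def)
  have "solves_scheme \<nu> G Vh \<tau> \<delta> N V' R"
    using sol V' sequence_cong(3)[OF eq] by (simp add: solves_scheme_def)
  moreover have "energy_norm_sq \<nu> G \<tau> \<delta> N V = energy_norm_sq \<nu> G \<tau> \<delta> N V'"
    using eq by (rule sequence_cong(6))
  moreover have "initial_sq \<nu> G \<delta> V = initial_sq \<nu> G \<delta> V'"
    using eq N by (rule sequence_cong(5))
  ultimately show ?thesis
    using stability_of_extended_solution[OF nu assms(2-4) Vh inv c small N _ V'] unfolding \<kappa>_def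
    by (simp only:)
qed

text \<open>
  For \<open>\<delta> = b\<^sub>0\<tau>\<close> the unknown enters \<open>A\<^sub>\<tau>\<close> through \<open>T\<^sub>\<delta>/\<tau>\<close>, so that trial and test functions carry the same
  operator.
\<close>
lemma step_form_normal_equation:
  assumes nu: "\<nu> \<in> {3, 4, 5}" and "0 < \<tau>" "n0 \<nu> \<le> n" "U \<in> \<V>"
  shows "step_form \<nu> G \<tau> (am_coeff \<nu> 0 * \<tau>) n U W
    = inner (T_op G (am_coeff \<nu> 0 * \<tau>) U) (T_op G (am_coeff \<nu> 0 * \<tau>) W) / \<tau>"
proof -
  let ?Y = "(\<lambda>_. 0)(n := U)"
  have "M_op \<nu> ?Y n = (\<Sum>j<\<nu>. if j = 0 then am_coeff \<nu> 0 *\<^sub>R U else 0)"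
    unfolding M_op_def using assms by (intro sum.cong) (auto simp: n0_def)
  also have "\<dots> = am_coeff \<nu> 0 *\<^sub>R U"
    using nu by auto
  finally have "A_op \<nu> G \<tau> ?Y n = (1 / \<tau>) *\<^sub>R U + am_coeff \<nu> 0 *\<^sub>R G U"
    using assms by (auto simp: A_op_def D_op_def G_scale n0_def)
  also have "\<dots> = (1 / \<tau>) *\<^sub>R T_op G (am_coeff \<nu> 0 * \<tau>) U"
    using \<open>0 < \<tau>\<close> by (simp add: T_op_def scaleR_add_right)
  finally show ?thesis
    by (simp add: step_form_def)
qed

end

text \<open>
  Over \<open>N \<le> T/\<tau>\<close> steps the rate \<open>(\<tau>/h)\<^sup>p\<^sup>+\<^sup>1\<close> accumulates to \<open>T \<tau>\<^sup>p/h\<^sup>p\<^sup>+\<^sup>1\<close>, and the condition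
  \<open>\<tau> \<le> C h\<^sup>(\<^sup>p\<^sup>+\<^sup>1\<^sup>)\<^sup>/\<^sup>p\<close> bounds this by \<open>T C\<^sup>p\<close>; here \<open>p = 3\<close> for AM3 and \<open>p = 5\<close> for AM4.
\<close>
lemma growth_bound:
  assumes nu: "\<nu> \<in> {3, 4, 5}" and "0 < h" "0 < \<tau>" "0 \<le> a" and cfl: "cfl \<nu> C_G c0 C43 C65 h \<tau>"
    and T: "real N * \<tau> \<le> T"
  defines "\<kappa> \<equiv> a / h * \<tau>"
  shows "(if \<nu> = 3 then \<kappa> ^ 4 else if \<nu> = 4 then \<kappa> ^ 6 else 0) * real N
    \<le> (a ^ 4 + a ^ 6) * growth_exponent \<nu> T C43 C65"
proof -
  have key: "\<kappa> ^ Suc p * real N \<le> a ^ Suc p * (T * C ^ p)"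
    if C: "\<tau> \<le> C * h powr (real (Suc p) / real p)" and "0 < p" for C p
  proof -
    have "\<tau> ^ p \<le> (C * h powr (real (Suc p) / real p)) ^ p"
      using C \<open>0 < \<tau>\<close> by (intro power_mono) auto
    also have "\<dots> = C ^ p * h ^ Suc p"
    proof -
      have "(h powr (real (Suc p) / real p)) ^ p = h powr (real (Suc p) / real p * real p)"
        using \<open>0 < h\<close> by (metis powr_gt_zero powr_powr powr_realpow)
      also have "\<dots> = h ^ Suc p"
        using \<open>0 < h\<close> \<open>0 < p\<close> powr_realpow[of h "Suc p"] by simp
      finally show ?thesis
        by (simp add: power_mult_distrib)
    qed
    finally have p: "\<tau> ^ p \<le> C ^ p * h ^ Suc p" .
    have "0 < C * h powr (real (Suc p) / real p)"
      using C \<open>0 < \<tau>\<close> by linarith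
    then have "0 < C"
      using \<open>0 < h\<close> by (simp add: zero_less_mult_iff)
    have "\<kappa> ^ Suc p * real N = a ^ Suc p * (\<tau> ^ p / h ^ Suc p) * (real N * \<tau>)"
      by (simp add: \<kappa>_def power_divide power_mult_distrib)
    also have "\<dots> \<le> a ^ Suc p * C ^ p * T"
      using p T \<open>0 < h\<close> \<open>0 < \<tau>\<close> \<open>0 \<le> a\<close> \<open>0 < C\<close>
      by (intro mult_mono mult_left_mono) (auto simp: pos_divide_le_eq)
    finally show ?thesis
      by (simp add: mult_ac)
  qed
  have pos: "0 \<le> growth_exponent \<nu> T C43 C65"
  proof -
    have "0 \<le> T"
      using T \<open>0 < \<tau>\<close> by (meson order_trans less_imp_le mult_nonneg_nonneg of_nat_0_le_iff)
    moreover have "0 \<le> C43" if "\<nu> = 3"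
    proof -
      have "0 < C43 * h powr (4/3)"
        using cfl that \<open>0 < \<tau>\<close> by (auto simp: cfl_def)
      then show ?thesis
        using \<open>0 < h\<close> by (simp add: zero_less_mult_iff)
    qed
    moreover have "0 \<le> C65" if "\<nu> = 4"
    proof -
      have "0 < C65 * h powr (6/5)"
        using cfl that \<open>0 < \<tau>\<close> by (auto simp: cfl_def)
      then show ?thesis
        using \<open>0 < h\<close> by (simp add: zero_less_mult_iff)
    qed
    ultimately show ?thesis
      by (simp add: growth_exponent_def)
  qed
  consider "\<nu> = 3" | "\<nu> = 4" | "\<nu> = 5"
    using nu by blast
  then show ?thesis
  proof cases
    case 1
    then have "\<kappa> ^ 4 * real N \<le> a ^ 4 * growth_exponent \<nu> T C43 C65"
      using key[of C43 3] cfl by (simp add: cfl_def growth_exponent_def)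
    also have "\<dots> \<le> (a ^ 4 + a ^ 6) * growth_exponent \<nu> T C43 C65"
      using pos \<open>0 \<le> a\<close> by (intro mult_right_mono) auto
    finally show ?thesis
      using 1 by simp
  next
    case 2
    then have "\<kappa> ^ 6 * real N \<le> a ^ 6 * growth_exponent \<nu> T C43 C65"
      using key[of C65 5] cfl by (simp add: cfl_def growth_exponent_def)
    also have "\<dots> \<le> (a ^ 4 + a ^ 6) * growth_exponent \<nu> T C43 C65"
      using pos \<open>0 \<le> a\<close> by (intro mult_right_mono) auto
    finally show ?thesis
      using 2 by simp
  next
    case 3
    then show ?thesis
      by (simp add: growth_exponent_def)
  qed
qed

lemma stability_estimate_uniform:
  fixes \<V> :: "'a::{real_inner,complete_space} set"
  assumes nu: "\<nu> \<in> {3, 4, 5}" and skew: "skew_operator \<V> G" and C_G: "0 < C_G" and C\<delta>: "0 < C\<delta>"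
  shows "\<exists>cstar>0. \<forall>c0. 0 < c0 \<and> c0 \<le> cstar \<longrightarrow>
        (\<exists>K>0. \<exists>L>0. \<forall>h>0. \<forall>\<tau>>0. \<forall>\<delta> T C43 C65.
           0 < \<delta> \<and> \<delta> \<le> C\<delta> * h \<and> cfl \<nu> C_G c0 C43 C65 h \<tau> \<longrightarrow>
           stability_estimate \<nu> \<V> G C_G h \<tau> \<delta> T
             (K * exp (L * growth_exponent \<nu> T C43 C65)))"
proof -
  interpret skew \<V> G
    by unfold_locales (rule skew)
  \<comment> \<open>\<open>c\<close> bounds \<open>\<delta> C\<^sub>G/h\<close>, and \<open>b\<close> is the resulting equivalence constant of the squared graph norm.\<close>
  define c where "c = C\<delta> * C_G"
  define b where "b = 1 + c\<^sup>2"
  define a where "a = b * C_G"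
  define K :: real where "K = 16000000000000000 * b\<^sup>2"
  define L :: real where "L = 80000000 * (a ^ 4 + a ^ 6)"
  have b: "0 < b"
    unfolding b_def by (rule add_pos_nonneg) auto
  then have a: "0 < a"
    using C_G by (simp add: a_def)
  have "stability_estimate \<nu> \<V> G C_G h \<tau> \<delta> T (K * exp (L * growth_exponent \<nu> T C43 C65))"
    if c0: "c0 \<le> 1 / (1000 * b)" and pos: "0 < h" "0 < \<tau>" "0 < \<delta>" and \<delta>: "\<delta> \<le> C\<delta> * h"
      and cfl: "cfl \<nu> C_G c0 C43 C65 h \<tau>" for c0 h \<tau> \<delta> T C43 C65
    unfolding stability_estimate_def
  proof (intro allI impI, elim conjE)
    fix Vh N and V R :: "nat \<Rightarrow> 'a"
    assume Vh: "finite_dim_subspace Vh" "Vh \<subseteq> \<V>" and inv: "inverse_inequality G Vh C_G h"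
      and N: "n0 \<nu> \<le> N" "real N * \<tau> \<le> T" and sol: "solves_scheme \<nu> G Vh \<tau> \<delta> N V R"
    define \<kappa> where "\<kappa> = a / h * \<tau>"
    define gr where "gr = (if \<nu> = 3 then \<kappa> ^ 4 else if \<nu> = 4 then \<kappa> ^ 6 else 0)"
    define D where "D = initial_sq \<nu> G \<delta> V + (dual_norm \<nu> G Vh \<tau> \<delta> N R)\<^sup>2 + \<tau> * l2_norm_sq \<tau> (n0 \<nu>) N R"
    have sub: "subspace Vh"
      using Vh(1) by (auto simp: finite_dim_subspace_def)
    have k: "(1 + c\<^sup>2) * (C_G / h) * \<tau> = \<kappa>"
      by (simp add: \<kappa>_def a_def b_def)
    have "\<delta> * (C_G / h) \<le> c"
      using \<delta> pos C_G by (simp add: c_def field_simps)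
    moreover have "\<kappa> \<le> 1 / 1000"
    proof -
      have "C_G / h * \<tau> \<le> C_G / h * (c0 / C_G * h)"
        using cfl C_G pos by (intro mult_left_mono) (auto simp: cfl_def)
      also have "\<dots> = c0"
        using C_G pos by simp
      finally have "b * (C_G / h * \<tau>) \<le> b * (1 / (1000 * b))"
        using c0 b by (intro mult_left_mono) auto
      then show ?thesis
        using b by (simp add: \<kappa>_def a_def)
    qed
    moreover have "norm (G W) \<le> C_G / h * norm W" if "W \<in> Vh" for W
      using inv that by (simp add: inverse_inequality_def)
    ultimately have "energy_norm_sq \<nu> G \<tau> \<delta> N V \<le> K * exp (80000000 * gr * real N) * D"
      using stability_of_solution[of \<nu> \<tau> \<delta> "C_G / h" Vh c N V R] nu pos C_G sub Vh(2) N(1) sol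
      unfolding k K_def gr_def D_def b_def by simp
    also have "\<dots> \<le> K * exp (L * growth_exponent \<nu> T C43 C65) * D"
    proof (intro mult_right_mono mult_left_mono)
      have "gr * real N \<le> (a ^ 4 + a ^ 6) * growth_exponent \<nu> T C43 C65"
        unfolding gr_def \<kappa>_def using a by (intro growth_bound[OF nu pos(1,2) _ cfl N(2)]) auto
      then show "exp (80000000 * gr * real N) \<le> exp (L * growth_exponent \<nu> T C43 C65)"
        unfolding L_def exp_le_cancel_iff mult.assoc by (intro mult_left_mono) auto
      show "0 \<le> D"
        using pos energy_norm_parts_nonneg(1)[of \<tau> \<delta> \<nu> V] by (simp add: D_def l2_norm_sq_def sum_nonneg)
    qed (simp add: K_def)
    finally show "energy_norm_sq \<nu> G \<tau> \<delta> N V \<le> K * exp (L * growth_exponent \<nu> T C43 C65)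
        * (initial_sq \<nu> G \<delta> V + (dual_norm \<nu> G Vh \<tau> \<delta> N R)\<^sup>2 + \<tau> * l2_norm_sq \<tau> (n0 \<nu>) N R)"
      unfolding D_def .
  qed
  note estimate = this
  have pos: "0 < K" "0 < L" "0 < 1 / (1000 * b)"
    using a b by (simp_all add: K_def L_def add_pos_pos)
  show ?thesis
    by (rule exI[of _ "1 / (1000 * b)"], intro conjI allI impI pos,
        rule exI[of _ K], intro conjI pos, rule exI[of _ L], intro conjI pos allI impI,
        elim conjE, rule estimate)
qed

theorem theorem5p1:
  fixes \<nu> :: nat
    and \<V> :: "'a::{real_inner,complete_space} set"
    and G :: "'a \<Rightarrow> 'a"
  assumes "\<nu> \<in> {3, 4, 5}"
    and "skew_operator \<V> G"
  shows
    "(\<forall>C_G>0. \<forall>C\<delta>>0. \<exists>cstar>0. \<forall>c0. 0 < c0 \<and> c0 \<le> cstar \<longrightarrow>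
        (\<exists>K>0. \<exists>L>0. \<forall>h>0. \<forall>\<tau>>0. \<forall>\<delta> T C43 C65.
           0 < \<delta> \<and> \<delta> \<le> C\<delta> * h \<and> cfl \<nu> C_G c0 C43 C65 h \<tau> \<longrightarrow>
           stability_estimate \<nu> \<V> G C_G h \<tau> \<delta> T
             (K * exp (L * growth_exponent \<nu> T C43 C65))))
   \<and> (\<forall>C_G>0. \<exists>cstar>0. \<forall>c0. 0 < c0 \<and> c0 \<le> cstar \<longrightarrow>
        (\<exists>K>0. \<exists>L>0. \<forall>h>0. \<forall>\<tau>>0. \<forall>T C43 C65.
           cfl \<nu> C_G c0 C43 C65 h \<tau> \<longrightarrow>
           stability_estimate \<nu> \<V> G C_G h \<tau> (am_coeff \<nu> 0 * \<tau>) T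
             (K * exp (L * growth_exponent \<nu> T C43 C65))))
   \<and> (\<forall>\<tau>>0. \<forall>Vh n. finite_dim_subspace Vh \<and> Vh \<subseteq> \<V> \<and> n0 \<nu> \<le> n \<longrightarrow>
        (\<forall>U\<in>Vh. \<forall>W\<in>Vh. step_form \<nu> G \<tau> (am_coeff \<nu> 0 * \<tau>) n U W
                          = step_form \<nu> G \<tau> (am_coeff \<nu> 0 * \<tau>) n W U) \<and>
        (\<forall>U\<in>Vh. U \<noteq> 0 \<longrightarrow> step_form \<nu> G \<tau> (am_coeff \<nu> 0 * \<tau>) n U U > 0))"
proof (intro conjI)
  interpret skew \<V> G
    by unfold_locales (rule assms(2))
  show first: "\<forall>C_G>0. \<forall>C\<delta>>0. \<exists>cstar>0. \<forall>c0. 0 < c0 \<and> c0 \<le> cstar \<longrightarrow>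
        (\<exists>K>0. \<exists>L>0. \<forall>h>0. \<forall>\<tau>>0. \<forall>\<delta> T C43 C65.
           0 < \<delta> \<and> \<delta> \<le> C\<delta> * h \<and> cfl \<nu> C_G c0 C43 C65 h \<tau> \<longrightarrow>
           stability_estimate \<nu> \<V> G C_G h \<tau> \<delta> T
             (K * exp (L * growth_exponent \<nu> T C43 C65)))"
    by (intro allI impI stability_estimate_uniform assms)
  have b0: "0 < am_coeff \<nu> 0" "am_coeff \<nu> 0 \<le> 1"
    using assms(1) by (auto simp: am_coeff_def)
  show "\<forall>C_G>0. \<exists>cstar>0. \<forall>c0. 0 < c0 \<and> c0 \<le> cstar \<longrightarrow>
        (\<exists>K>0. \<exists>L>0. \<forall>h>0. \<forall>\<tau>>0. \<forall>T C43 C65.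
           cfl \<nu> C_G c0 C43 C65 h \<tau> \<longrightarrow>
           stability_estimate \<nu> \<V> G C_G h \<tau> (am_coeff \<nu> 0 * \<tau>) T
             (K * exp (L * growth_exponent \<nu> T C43 C65)))"
  proof (intro allI impI)
    fix C_G :: real assume C_G: "0 < C_G"
    obtain cstar where cstar: "0 < cstar"
      and est: "\<And>c0. 0 < c0 \<and> c0 \<le> cstar \<Longrightarrow> (\<exists>K>0. \<exists>L>0. \<forall>h>0. \<forall>\<tau>>0. \<forall>\<delta> T C43 C65.
           0 < \<delta> \<and> \<delta> \<le> 1 / C_G * h \<and> cfl \<nu> C_G c0 C43 C65 h \<tau> \<longrightarrow>
           stability_estimate \<nu> \<V> G C_G h \<tau> \<delta> T (K * exp (L * growth_exponent \<nu> T C43 C65)))"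
      \<comment> \<open>For \<open>c0 \<le> 1\<close> one has \<open>b\<^sub>0\<tau> \<le> \<tau> \<le> h/C\<^sub>G\<close>, so the constant \<open>1/C\<^sub>G\<close> serves for \<open>C\<^sub>\<delta>\<close>.\<close>
      using first[rule_format, OF C_G, of "1 / C_G"] C_G by auto
    show "\<exists>cstar>0. \<forall>c0. 0 < c0 \<and> c0 \<le> cstar \<longrightarrow>
        (\<exists>K>0. \<exists>L>0. \<forall>h>0. \<forall>\<tau>>0. \<forall>T C43 C65.
           cfl \<nu> C_G c0 C43 C65 h \<tau> \<longrightarrow>
           stability_estimate \<nu> \<V> G C_G h \<tau> (am_coeff \<nu> 0 * \<tau>) T
             (K * exp (L * growth_exponent \<nu> T C43 C65)))"
    proof (rule exI[of _ "min cstar 1"], intro conjI allI impI)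
      fix c0 :: real assume c0: "0 < c0 \<and> c0 \<le> min cstar 1"
      have \<delta>: "0 < am_coeff \<nu> 0 * \<tau> \<and> am_coeff \<nu> 0 * \<tau> \<le> 1 / C_G * h"
        if "0 < h" "0 < \<tau>" "cfl \<nu> C_G c0 C43 C65 h \<tau>" for h \<tau> C43 C65
      proof -
        have "am_coeff \<nu> 0 * \<tau> \<le> 1 * \<tau>"
          using b0 that by (intro mult_right_mono) auto
        also have "\<dots> \<le> c0 / C_G * h"
          using that by (simp add: cfl_def)
        also have "\<dots> \<le> 1 / C_G * h"
          using c0 C_G that by (intro mult_right_mono divide_right_mono) auto
        finally show ?thesis
          using b0 that by simp
      qed
      obtain K L where "0 < K" "0 < L" and KL: "\<forall>h>0. \<forall>\<tau>>0. \<forall>\<delta> T C43 C65.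
           0 < \<delta> \<and> \<delta> \<le> 1 / C_G * h \<and> cfl \<nu> C_G c0 C43 C65 h \<tau> \<longrightarrow>
           stability_estimate \<nu> \<V> G C_G h \<tau> \<delta> T (K * exp (L * growth_exponent \<nu> T C43 C65))"
        using est[of c0] c0 by auto
      show "\<exists>K>0. \<exists>L>0. \<forall>h>0. \<forall>\<tau>>0. \<forall>T C43 C65.
           cfl \<nu> C_G c0 C43 C65 h \<tau> \<longrightarrow>
           stability_estimate \<nu> \<V> G C_G h \<tau> (am_coeff \<nu> 0 * \<tau>) T
             (K * exp (L * growth_exponent \<nu> T C43 C65))"
      proof (rule exI[of _ K], intro conjI \<open>0 < K\<close>, rule exI[of _ L], intro conjI allI impI \<open>0 < L\<close>)
        fix h \<tau> T C43 C65 :: real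
        assume h: "0 < h" "0 < \<tau>" "cfl \<nu> C_G c0 C43 C65 h \<tau>"
        show "stability_estimate \<nu> \<V> G C_G h \<tau> (am_coeff \<nu> 0 * \<tau>) T
             (K * exp (L * growth_exponent \<nu> T C43 C65))"
          using KL[rule_format, OF h(1,2)] \<delta>[OF h] h(3) by blast
      qed
    qed (use cstar in simp)
  qed
  show "\<forall>\<tau>>0. \<forall>Vh n. finite_dim_subspace Vh \<and> Vh \<subseteq> \<V> \<and> n0 \<nu> \<le> n \<longrightarrow>
        (\<forall>U\<in>Vh. \<forall>W\<in>Vh. step_form \<nu> G \<tau> (am_coeff \<nu> 0 * \<tau>) n U W
                          = step_form \<nu> G \<tau> (am_coeff \<nu> 0 * \<tau>) n W U) \<and>
        (\<forall>U\<in>Vh. U \<noteq> 0 \<longrightarrow> step_form \<nu> G \<tau> (am_coeff \<nu> 0 * \<tau>) n U U > 0)"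
  proof (intro allI impI conjI ballI; elim conjE)
    fix \<tau> :: real and Vh n U W
    assume A: "0 < \<tau>" "Vh \<subseteq> \<V>" "n0 \<nu> \<le> n" "U \<in> Vh" "W \<in> Vh"
    then show "step_form \<nu> G \<tau> (am_coeff \<nu> 0 * \<tau>) n U W = step_form \<nu> G \<tau> (am_coeff \<nu> 0 * \<tau>) n W U"
      using assms(1) by (subst (1 2) step_form_normal_equation) (auto simp: inner_commute)
  next
    fix \<tau> :: real and Vh n U
    assume A: "0 < \<tau>" "Vh \<subseteq> \<V>" "n0 \<nu> \<le> n" "U \<in> Vh" "U \<noteq> 0"
    then have "T_op G (am_coeff \<nu> 0 * \<tau>) U \<noteq> 0"
      using norm_le_norm_T[of U "am_coeff \<nu> 0 * \<tau>"] by auto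
    then show "0 < step_form \<nu> G \<tau> (am_coeff \<nu> 0 * \<tau>) n U U"
      using A assms(1) by (subst step_form_normal_equation) auto
  qed
qed

end
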